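(* The perspector of $ABC$ and the tangential triangle $abc$ of $ABC$ with respect to the circumconic $\tilde{\mathcal{C}}_O$ is $\gamma_P(G)$.
   Context: We work in the Euclidean plane extended by its line at infinity $l_\infty$; affine maps are extended to $l_\infty$. $ABC$ is an ordinary non-degenerate triangle with centroid $G$; its sides are the lines $BC, CA, AB$. $X_1X_2\cdot Y_1Y_2$ denotes the intersection of two lines. $K$ is the complement map (homothety with center $G$ and ratio $-1/2$); $K^{-1}(ABC)$ is the anticomplementary triangle. $\iota$ is the isotomic map, $(x:y:z)\mapsto(1/x:1/y:1/z)$ in barycentric coordinates. $P$ is a point not on the sides of $ABC$ or $K^{-1}(ABC)$; $P'=\iota(P)$, $Q=K(P')$, $D=AP\cdot BC$, $E=BP\cdot CA$, $F=CP\cdot AB$, and $D_3E_3F_3$ is the cevian triangle of $P'$. Generalized isogonal map $\gamma_P$: let $h_a$ be the affine reflection about the line $AQ$ in the direction of $EF$ (i.e. $h_a(X)=X'$ with $XX'\parallel EF$ and the midpoint of $XX'$ on $AQ$), $h_b$ the affine reflection about $BQ$ in the direction $DF$, and $h_c$ the affine reflection about $CQ$ in the direction $DE$. For $X\neq A,B,C$, $\gamma_P(X)$ is the common point of the lines $Ah_a(X),Bh_b(X),Ch_c(X)$ (which are concurrent). The circumconic $\tilde{\mathcal{C}}_O$: let $T_{P'}$ be the affine map taking $A,B,C$ to $D_3,E_3,F_3$, and let $\mathcal{N}_{P'}$ be the nine-point conic of the quadrangle $ABCP'$ with respect to $l_\infty$, i.e. the locus of poles of $l_\infty$ with respect to the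 conics through $A,B,C,P'$; it passes through the diagonal points $D_3,E_3,F_3$ and through the midpoint of each side of the quadrangle (the midpoint of a side with one vertex at infinity being that infinite vertex). Then $\tilde{\mathcal{C}}_O=T_{P'}^{-1}(\mathcal{N}_{P'})$; it is a conic through $A,B,C$ with center $O=T_{P'}^{-1}(K(Q))$. The tangential triangle of $ABC$ with respect to $\tilde{\mathcal{C}}_O$ is the triangle whose sides are the tangents $a,b,c$ to $\tilde{\mathcal{C}}_O$ at $A,B,C$; its vertex corresponding to $A$ is $b\cdot c$ (possibly on $l_\infty$), and cyclically. The perspector of two triangles is the point common to the three lines joining corresponding vertices. *)

theory Defs
  imports "HOL-Analysis.Analysis"
begin

section \<open>The Euclidean plane extended by its line at infinity\<close>

text \<open>
  Points of the extended plane are given by homogeneous coordinates: for \<open>w \<noteq> 0\<close> the triple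
  \<open>(v, w)\<close> is the ordinary point \<open>v / w\<close>, and \<open>(v, 0)\<close> is the point at infinity
  of the lines with direction \<open>v\<close>.
\<close>

type_synonym hvec = "(real^2) \<times> real"

definition proportional :: "hvec \<Rightarrow> hvec \<Rightarrow> bool" where
  "proportional u v \<longleftrightarrow> u \<noteq> 0 \<and> v \<noteq> 0 \<and> (\<exists>c. c \<noteq> 0 \<and> v = c *\<^sub>R u)"

lemma part_equivp_proportional: "part_equivp proportional"
proof (rule part_equivpI)
  obtain u :: hvec where "u \<noteq> 0" using zero_neq_one[where 'a = real]
    by (metis prod.inject zero_prod_def)
  then have "proportional u u"
    unfolding proportional_def by (metis scaleR_one zero_neq_one)
  then show "\<exists>x. proportional x x" by blast
  show "symp proportional"
  proof (rule sympI)
    fix u v assume "proportional u v"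
    then obtain c where c: "u \<noteq> 0" "v \<noteq> 0" "c \<noteq> 0" "v = c *\<^sub>R u"
      unfolding proportional_def by blast
    then have "u = inverse c *\<^sub>R v" by simp
    with c show "proportional v u"
      unfolding proportional_def by (metis nonzero_imp_inverse_nonzero)
  qed
  show "transp proportional"
  proof (rule transpI)
    fix u v w assume "proportional u v" "proportional v w"
    then obtain c d where "u \<noteq> 0" "w \<noteq> 0" "c \<noteq> 0" "d \<noteq> 0" "v = c *\<^sub>R u" "w = d *\<^sub>R v"
      unfolding proportional_def by blast
    then show "proportional u w"
      unfolding proportional_def by (metis mult_eq_0_iff scaleR_scaleR)
  qed
qed

quotient_type epoint = hvec / partial: proportional
  morphisms coords proj
  by (rule part_equivp_proportional)

text \<open>
  \<open>coords X\<close> is one (arbitrarily chosen) nonzero coordinate vector of \<open>X\<close>; it is used below only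
  in ways that do not depend on the choice.
\<close>

definition ordinary :: "real^2 \<Rightarrow> epoint" where
  "ordinary X = proj (X, 1)"

definition is_line :: "epoint set \<Rightarrow> bool" where
  "is_line L \<longleftrightarrow> (\<exists>l. l \<noteq> 0 \<and> L = {X. inner l (coords X) = 0})"

definition l_inf :: "epoint set" where
  "l_inf = {X. snd (coords X) = 0}"

definition line_through :: "epoint \<Rightarrow> epoint \<Rightarrow> epoint set" where
  "line_through X Y = (THE L. is_line L \<and> X \<in> L \<and> Y \<in> L)"

definition meet :: "epoint set \<Rightarrow> epoint set \<Rightarrow> epoint" where
  "meet L M = (THE X. X \<in> L \<and> X \<in> M)"

definition parallel_lines :: "epoint set \<Rightarrow> epoint set \<Rightarrow> bool" where
  "parallel_lines L M \<longleftrightarrow> (\<exists>Z \<in> l_inf. Z \<in> L \<and> Z \<in> M)"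

definition affine_map :: "(real^2 \<Rightarrow> real^2) \<Rightarrow> bool" where
  "affine_map f \<longleftrightarrow> (\<exists>L b. linear L \<and> f = (\<lambda>X. L X + b))"

text \<open>
  The extension of a bijective affine map \<open>f X = L X + b\<close> to \<open>l_inf\<close>: here \<open>b = f 0\<close> and
  \<open>L v = f v - f 0\<close>, so that \<open>(v, w)\<close> is sent to \<open>(L v + w b, w)\<close>.
\<close>

definition ext :: "(real^2 \<Rightarrow> real^2) \<Rightarrow> epoint \<Rightarrow> epoint" where
  "ext f X = (case coords X of (v, w) \<Rightarrow> proj ((f v - f 0) + w *\<^sub>R f 0, w))"

text \<open>The point with homogeneous barycentric coordinates \<open>(x : y : z)\<close> with respect to \<open>ABC\<close>.\<close>

definition bary :: "real^2 \<Rightarrow> real^2 \<Rightarrow> real^2 \<Rightarrow> real \<Rightarrow> real \<Rightarrow> real \<Rightarrow> epoint" where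
  "bary A B C x y z = proj (x *\<^sub>R (A, 1) + y *\<^sub>R (B, 1) + z *\<^sub>R (C, 1))"


section \<open>Conics\<close>

text \<open>
  A conic is given by a nonzero symmetric bilinear form on coordinate vectors, so degenerate
  conics (line pairs) are included.
\<close>

definition conic_form :: "(hvec \<Rightarrow> hvec \<Rightarrow> real) \<Rightarrow> bool" where
  "conic_form h \<longleftrightarrow> bilinear h \<and> (\<forall>x y. h x y = h y x) \<and> (\<exists>x y. h x y \<noteq> 0)"

definition conic_points :: "(hvec \<Rightarrow> hvec \<Rightarrow> real) \<Rightarrow> epoint set" where
  "conic_points h = {X. h (coords X) (coords X) = 0}"

text \<open>
  \<open>X\<close> is a pole of the line \<open>L\<close> if it is conjugate to every point of \<open>L\<close>.  For a nondegenerate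
  conic this says that \<open>L\<close> is the polar of \<open>X\<close>; for a pair of lines meeting in a point \<open>V\<close>
  not on \<open>L\<close> the only pole of \<open>L\<close> is \<open>V\<close>, which is how the diagonal points of a quadrangle come to lie
  on its nine-point conic.
\<close>

definition is_pole :: "(hvec \<Rightarrow> hvec \<Rightarrow> real) \<Rightarrow> epoint \<Rightarrow> epoint set \<Rightarrow> bool" where
  "is_pole h X L \<longleftrightarrow> (\<forall>Y \<in> L. h (coords X) (coords Y) = 0)"

definition nine_point_conic :: "epoint \<Rightarrow> epoint \<Rightarrow> epoint \<Rightarrow> epoint \<Rightarrow> epoint set" where
  "nine_point_conic X1 X2 X3 X4 =
     {X. \<exists>h. conic_form h \<and> {X1, X2, X3, X4} \<subseteq> conic_points h \<and> is_pole h X l_inf}"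

text \<open>
  The tangent to a nondegenerate conic \<open>S\<close>, given as a set of points of the extended plane, at a
  point \<open>X\<close> of \<open>S\<close>: the unique line that meets \<open>S\<close> in \<open>X\<close> only.  Since points at infinity are taken into
  account, this excludes parallels to the axis of a parabola or to an asymptote of a hyperbola.
\<close>

definition tangent :: "epoint set \<Rightarrow> epoint \<Rightarrow> epoint set" where
  "tangent S X = (THE L. is_line L \<and> L \<inter> S = {X})"


section \<open>Triangles\<close>

definition side_points :: "real^2 \<Rightarrow> real^2 \<Rightarrow> real^2 \<Rightarrow> epoint set" where
  "side_points A B C =
     line_through (ordinary B) (ordinary C) \<union>
     line_through (ordinary C) (ordinary A) \<union>
     line_through (ordinary A) (ordinary B)"

definition is_perspector ::
    "epoint \<Rightarrow> epoint \<Rightarrow> epoint \<Rightarrow> epoint \<Rightarrow> epoint \<Rightarrow> epoint \<Rightarrow> epoint \<Rightarrow> bool" where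
  "is_perspector X1 X2 X3 Y1 Y2 Y3 Z \<longleftrightarrow>
     X1 \<noteq> Y1 \<and> X2 \<noteq> Y2 \<and> X3 \<noteq> Y3 \<and>
     line_through X1 Y1 \<inter> line_through X2 Y2 \<inter> line_through X3 Y3 = {Z}"

definition centroid :: "real^2 \<Rightarrow> real^2 \<Rightarrow> real^2 \<Rightarrow> real^2" where
  "centroid A B C = (1/3) *\<^sub>R (A + B + C)"

definition complement_map :: "real^2 \<Rightarrow> real^2 \<Rightarrow> real^2 \<Rightarrow> real^2 \<Rightarrow> real^2" where
  "complement_map A B C X = centroid A B C + (- 1/2) *\<^sub>R (X - centroid A B C)"

text \<open>Defined for points not on the sides of \<open>ABC\<close>.\<close>

definition isotomic :: "real^2 \<Rightarrow> real^2 \<Rightarrow> real^2 \<Rightarrow> epoint \<Rightarrow> epoint" where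
  "isotomic A B C X = (THE Y. \<exists>x y z. x \<noteq> 0 \<and> y \<noteq> 0 \<and> z \<noteq> 0 \<and>
     X = bary A B C x y z \<and> Y = bary A B C (1/x) (1/y) (1/z))"

text \<open>
  The vertex on \<open>BC\<close> of the cevian triangle of \<open>P\<close>; the other two are
  \<open>cevian_foot B C A P\<close> and \<open>cevian_foot C A B P\<close>.
\<close>

definition cevian_foot :: "real^2 \<Rightarrow> real^2 \<Rightarrow> real^2 \<Rightarrow> epoint \<Rightarrow> epoint" where
  "cevian_foot A B C P =
     meet (line_through (ordinary A) P) (line_through (ordinary B) (ordinary C))"


section \<open>The generalized isogonal map\<close>

text \<open>
  The affine reflection about the line \<open>L\<close> in the direction of the line \<open>M\<close>.  Points on \<open>L\<close> are
  fixed; for them there is no line joining the point to its image.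
\<close>

definition affine_reflection :: "epoint set \<Rightarrow> epoint set \<Rightarrow> real^2 \<Rightarrow> real^2" where
  "affine_reflection L M X = (THE X'.
     (X' \<noteq> X \<longrightarrow> parallel_lines (line_through (ordinary X) (ordinary X')) M) \<and>
     ordinary (midpoint X X') \<in> L)"

definition Q_point :: "real^2 \<Rightarrow> real^2 \<Rightarrow> real^2 \<Rightarrow> epoint \<Rightarrow> epoint" where
  "Q_point A B C P = ext (complement_map A B C) (isotomic A B C P)"

text \<open>Defined for \<open>X\<close> different from \<open>A\<close>, \<open>B\<close>, \<open>C\<close>.\<close>

definition gen_isogonal :: "real^2 \<Rightarrow> real^2 \<Rightarrow> real^2 \<Rightarrow> epoint \<Rightarrow> epoint \<Rightarrow> epoint" where
  "gen_isogonal A B C P X =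
    (let Q = Q_point A B C P;
         D = cevian_foot A B C P;
         E = cevian_foot B C A P;
         F = cevian_foot C A B P;
         h\<^sub>a = affine_reflection (line_through (ordinary A) Q) (line_through E F);
         h\<^sub>b = affine_reflection (line_through (ordinary B) Q) (line_through D F);
         h\<^sub>c = affine_reflection (line_through (ordinary C) Q) (line_through D E)
     in THE Y. Y \<in> line_through (ordinary A) (ext h\<^sub>a X) \<and>
               Y \<in> line_through (ordinary B) (ext h\<^sub>b X) \<and>
               Y \<in> line_through (ordinary C) (ext h\<^sub>c X))"


section \<open>The circumconic and the tangential triangle\<close>

text \<open>
  The affine map taking \<open>A\<close>, \<open>B\<close>, \<open>C\<close> to the vertices \<open>D\<^sub>3\<close>, \<open>E\<^sub>3\<close>, \<open>F\<^sub>3\<close> of the cevian triangle of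
  the given point.
\<close>

definition cevian_map :: "real^2 \<Rightarrow> real^2 \<Rightarrow> real^2 \<Rightarrow> epoint \<Rightarrow> real^2 \<Rightarrow> real^2" where
  "cevian_map A B C R = (THE f. affine_map f \<and>
     ordinary (f A) = cevian_foot A B C R \<and>
     ordinary (f B) = cevian_foot B C A R \<and>
     ordinary (f C) = cevian_foot C A B R)"

definition circumconic_O :: "real^2 \<Rightarrow> real^2 \<Rightarrow> real^2 \<Rightarrow> epoint \<Rightarrow> epoint set" where
  "circumconic_O A B C P =
    (let P' = isotomic A B C P
     in ext (cevian_map A B C P') -`
          nine_point_conic (ordinary A) (ordinary B) (ordinary C) P')"

text \<open>
  The vertex \<open>b \<cdot> c\<close> of the tangential triangle of \<open>ABC\<close> with respect to \<open>S\<close>, which corresponds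
  to \<open>A\<close>; the other two are obtained by cyclic permutation of \<open>A\<close>, \<open>B\<close>, \<open>C\<close>.
\<close>

definition tangential_vertex :: "epoint set \<Rightarrow> real^2 \<Rightarrow> real^2 \<Rightarrow> real^2 \<Rightarrow> epoint" where
  "tangential_vertex S A B C = meet (tangent S (ordinary B)) (tangent S (ordinary C))"

end

theory Submission
  imports Defs
begin

text \<open>
  Everything is computed in barycentric coordinates with respect to \<open>ABC\<close>.  Write
  \<open>P' = (x : y : z)\<close>, so that \<open>P = (yz : zx : xy)\<close>, and put \<open>a = (y + z)\<^sup>2\<close>, \<open>b = (z + x)\<^sup>2\<close>,
  \<open>c = (x + y)\<^sup>2\<close>.  The hypotheses on \<open>P\<close> make \<open>x, y, z\<close> and \<open>a, b, c\<close> nonzero; in particular all cevian feet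
  are ordinary points, even when \<open>P\<close> or \<open>P'\<close> lies at infinity.  Running coordinates are \<open>(u : v : w)\<close>.

  \<^emph>\<open>The isogonal side.\<close>  The point \<open>Q = (y + z : z + x : x + y)\<close> and the feet \<open>E = (z : 0 : x)\<close>,
  \<open>F = (y : x : 0)\<close> give an explicit affine reflection \<open>h\<^sub>a\<close>, and \<open>h\<^sub>a(G)\<close> turns out to lie on the line
  \<open>c v = b w\<close> through \<open>A\<close> (\<open>reflected_centroid_line\<close>).  By cyclic symmetry \<open>\<gamma>\<^sub>P(G) = (a : b : c)\<close>.

  \<^emph>\<open>The conic side.\<close>  A conic through \<open>A, B, C\<close> has an equation \<open>f v w + g w u + k u v = 0\<close>.
  Passing through \<open>P'\<close> and having \<open>(u : v : w)\<close> as a pole of the line at infinity are three linear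
  conditions on \<open>(f, g, k)\<close>, so the nine-point conic is the vanishing locus of a determinant
  (\<open>nine_point_conic_bary\<close>).  Pulling it back along the affine map onto the cevian triangle of \<open>P'\<close>
  gives the circumconic \<open>a v w + b w u + c u v = 0\<close> (\<open>circumconic_O_bary\<close>).  Its tangents at the
  vertices are \<open>c v + b w = 0\<close> and so on, the tangential triangle has the vertices
  \<open>(-a : b : c)\<close>, \<open>(a : -b : c)\<close>, \<open>(a : b : -c)\<close>, and the lines joining them to \<open>A, B, C\<close> meet in
  \<open>(a : b : c)\<close> (\<open>perspector_tangential_triangle\<close>).

  Statements are made for the vertex \<open>A\<close> of an arbitrary triangle and transferred to \<open>B\<close> and \<open>C\<close> by
  applying them to the triangles \<open>BCA\<close> and \<open>CAB\<close>, which permutes the coordinates cyclically.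
\<close>

section \<open>Homogeneous coordinates\<close>

lemma coords_nonzero: "coords X \<noteq> 0"
  using Quotient3_rep_reflp[OF Quotient3_epoint, of X] by (auto simp: proportional_def)

lemma proj_coords [simp]: "proj (coords X) = X"
  using Quotient3_epoint by (rule Quotient3_abs_rep)

lemma coords_proj:
  assumes "u \<noteq> 0"
  obtains k where "k \<noteq> 0" "coords (proj u) = k *\<^sub>R u"
proof -
  have "proportional u u" using assms unfolding proportional_def by (metis scaleR_one zero_neq_one)
  then have "proportional (coords (proj u)) u"
    using Quotient3_rep_abs[OF Quotient3_epoint] by blast
  then obtain c where "c \<noteq> 0" "u = c *\<^sub>R coords (proj u)" unfolding proportional_def by blast
  then have "inverse c *\<^sub>R u = inverse c *\<^sub>R c *\<^sub>R coords (proj u)" by (rule_tac arg_cong)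
  then have "coords (proj u) = inverse c *\<^sub>R u" using \<open>c \<noteq> 0\<close> by simp
  with that \<open>c \<noteq> 0\<close> show ?thesis by (metis nonzero_imp_inverse_nonzero)
qed

lemma proj_eq_iff:
  assumes "u \<noteq> 0" "v \<noteq> 0"
  shows "proj u = proj v \<longleftrightarrow> (\<exists>k. k \<noteq> 0 \<and> v = k *\<^sub>R u)"
proof -
  have "proportional w w" if "w \<noteq> 0" for w
    using that unfolding proportional_def by (metis scaleR_one zero_neq_one)
  then have "proportional u v \<longleftrightarrow> proj u = proj v"
    using Quotient3_rel[OF Quotient3_epoint, of u v] assms by auto
  then show ?thesis using assms by (auto simp: proportional_def)
qed

lemma proj_scale:
  assumes "k \<noteq> 0" shows "proj (k *\<^sub>R u) = proj u"
proof (cases "u = 0")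
  case False
  then show ?thesis using assms proj_eq_iff[of u "k *\<^sub>R u"] by auto
qed simp

lemma ordinary_eq_iff [simp]: "ordinary X = ordinary Y \<longleftrightarrow> X = Y"
  unfolding ordinary_def by (subst proj_eq_iff) (auto simp: zero_prod_def)

lemma proj_on_line:
  fixes l :: hvec
  assumes "u \<noteq> 0"
  shows "inner l (coords (proj u)) = 0 \<longleftrightarrow> inner l u = 0"
  by (rule coords_proj[OF assms]) simp

lemma proj_on_l_inf: "u \<noteq> 0 \<Longrightarrow> proj u \<in> l_inf \<longleftrightarrow> snd u = 0"
  by (rule coords_proj[of u]) (auto simp: l_inf_def)

text \<open>
  The representative that \<^const>\<open>coords\<close> picks is unknown, so the image of a single point under an
  extended map can only be found once the map is known to be affine everywhere.
\<close>

lemma ext_bary: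
  assumes "affine_map f" "(x, y, z) \<noteq> (0, 0, 0)"
    and nz: "x *\<^sub>R (A, 1) + y *\<^sub>R (B, 1) + z *\<^sub>R (C, 1 :: real) \<noteq> 0"
  shows "ext f (bary A B C x y z) = bary (f A) (f B) (f C) x y z"
proof -
  obtain L b where L: "linear L" and f: "f = (\<lambda>X. L X + b)"
    using assms(1) unfolding affine_map_def by blast
  interpret L: linear L by fact
  obtain k where k: "k \<noteq> 0"
    "coords (bary A B C x y z) = k *\<^sub>R (x *\<^sub>R (A, 1) + y *\<^sub>R (B, 1) + z *\<^sub>R (C, 1))"
    using coords_proj[OF nz] unfolding bary_def by blast
  have "ext f (bary A B C x y z) =
    proj (k *\<^sub>R (x *\<^sub>R (f A, 1) + y *\<^sub>R (f B, 1) + z *\<^sub>R (f C, 1)))"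
    unfolding ext_def k(2) f
    by (simp add: L.add L.scale L.zero algebra_simps)
  then show ?thesis unfolding bary_def by (simp only: proj_scale[OF k(1)])
qed

lemma ext_ordinary:
  assumes "affine_map f" shows "ext f (ordinary X) = ordinary (f X)"
  using ext_bary[OF assms, of 1 0 0 X X X] by (simp add: bary_def ordinary_def zero_prod_def)

lemma line_through_commute: "line_through X Y = line_through Y X"
  unfolding line_through_def by (rule arg_cong[where f = The]) auto

lemma proportional_triples:
  fixes x y z x' y' z' :: real
  assumes "(x, y, z) \<noteq> (0, 0, 0)" "(x', y', z') \<noteq> (0, 0, 0)"
    and "y * z' = z * y'" "z * x' = x * z'" "x * y' = y * x'"
  obtains k where "k \<noteq> 0" "x' = k * x" "y' = k * y" "z' = k * z"
proof -
  consider "x \<noteq> 0" | "y \<noteq> 0" | "z \<noteq> 0" using assms(1) by auto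
  then show ?thesis
  proof cases
    case 1
    show ?thesis by (rule that[of "x' / x"]) (use 1 assms in \<open>auto simp: field_simps\<close>)
  next
    case 2
    show ?thesis by (rule that[of "y' / y"]) (use 2 assms in \<open>auto simp: field_simps\<close>)
  next
    case 3
    show ?thesis by (rule that[of "z' / z"]) (use 3 assms in \<open>auto simp: field_simps\<close>)
  qed
qed

section \<open>Barycentric coordinates\<close>

locale triangle =
  fixes A B C :: "real^2"
  assumes noncollinear: "\<not> collinear {A, B, C}"
begin

lemma rotate: "triangle B C A"
  using noncollinear by unfold_locales (simp add: insert_commute)

definition hom :: "real \<Rightarrow> real \<Rightarrow> real \<Rightarrow> hvec" where
  "hom x y z = x *\<^sub>R (A, 1) + y *\<^sub>R (B, 1) + z *\<^sub>R (C, 1)"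

lemma bary_hom: "bary A B C x y z = proj (hom x y z)"
  by (simp add: bary_def hom_def)

lemma snd_hom [simp]: "snd (hom x y z) = x + y + z"
  by (simp add: hom_def)

lemma scale_hom: "k *\<^sub>R hom x y z = hom (k * x) (k * y) (k * z)"
  by (simp add: hom_def algebra_simps)

lemma add_hom: "hom x y z + hom x' y' z' = hom (x + x') (y + y') (z + z')"
  by (simp add: hom_def algebra_simps)

lemma diff_hom: "hom x y z - hom x' y' z' = hom (x - x') (y - y') (z - z')"
  by (simp add: hom_def algebra_simps)

lemma hom_eq_0: "hom x y z = 0 \<longleftrightarrow> (x, y, z) = (0, 0, 0)"
proof
  assume 0: "hom x y z = 0"
  then have s: "x = - y - z" and "x *\<^sub>R A + y *\<^sub>R B + z *\<^sub>R C = 0"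
    by (auto simp: hom_def zero_prod_def)
  then have e: "y *\<^sub>R (B - A) + z *\<^sub>R (C - A) = 0"
    by (simp only: s) (simp add: algebra_simps)
  have nc: "\<not> collinear {0, B - A, C - A}"
    using noncollinear collinear_3[of B A C] by (simp add: insert_commute)
  have "z = 0"
  proof (rule ccontr)
    assume z: "z \<noteq> 0"
    from e have "z *\<^sub>R (C - A) = (- y) *\<^sub>R (B - A)" by (simp add: eq_neg_iff_add_eq_0 add.commute)
    then have "(1 / z) *\<^sub>R z *\<^sub>R (C - A) = (1 / z) *\<^sub>R (- y) *\<^sub>R (B - A)" by (rule arg_cong)
    then have "C - A = (- y / z) *\<^sub>R (B - A)" using z by simp
    then show False using nc unfolding collinear_lemma by blast
  qed
  moreover from this e have "y = 0" using nc by (auto simp: collinear_lemma)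
  ultimately show "(x, y, z) = (0, 0, 0)" using s by simp
qed (simp add: hom_def prod_eq_iff)

text \<open>An injective linear map between spaces of dimension 3 is onto.\<close>

lemma hom_cases:
  obtains x y z where "u = hom x y z"
proof -
  let ?f = "\<lambda>t :: real \<times> real \<times> real. hom (fst t) (fst (snd t)) (snd (snd t))"
  have linear_f: "linear ?f" by (rule linearI) (simp_all add: hom_def algebra_simps)
  moreover have "t = 0" if "?f t = 0" for t
    using that[unfolded hom_eq_0] by (simp add: prod_eq_iff)
  ultimately have "inj ?f" by (simp only: linear_injective_0) blast
  then have "surj ?f" by (intro linear_injective_imp_surjective linear_f) simp_all
  then obtain t where "u = ?f t" by (rule surjE)
  then show ?thesis by (rule that)
qed

lemma bary_cases:
  obtains x y z where "X = bary A B C x y z" "(x, y, z) \<noteq> (0, 0, 0)"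
  by (metis bary_hom coords_nonzero proj_coords hom_cases hom_eq_0)

text \<open>
  The map sending a functional to its values at the three vertices is injective, because the vertices
  span, and hence onto by dimension.  With values 1, 0, 0 this also supplies the barycentric
  coordinates as functionals on coordinate vectors.
\<close>

lemma functional_exists:
  obtains l :: hvec where "\<And>x y z. inner l (hom x y z) = \<alpha> * x + \<beta> * y + \<gamma> * z"
proof -
  let ?f = "\<lambda>l :: hvec. (inner l (hom 1 0 0), inner l (hom 0 1 0), inner l (hom 0 0 1))"
  have split: "hom x y z = x *\<^sub>R hom 1 0 0 + y *\<^sub>R hom 0 1 0 + z *\<^sub>R hom 0 0 1" for x y z
    by (simp add: hom_def)
  have linear_f: "linear ?f" by (rule linearI) (simp_all add: inner_add_left)
  moreover have "l = 0" if "?f l = 0" for l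
  proof -
    obtain x y z where "l = hom x y z" by (rule hom_cases)
    then have "inner l l = inner l (x *\<^sub>R hom 1 0 0 + y *\<^sub>R hom 0 1 0 + z *\<^sub>R hom 0 0 1)"
      by (simp only: split[symmetric])
    also have "\<dots> = 0" using that by (simp add: inner_add_right zero_prod_def)
    finally show ?thesis by simp
  qed
  ultimately have "inj ?f" by (auto simp: linear_injective_0)
  then have "surj ?f" by (intro linear_injective_imp_surjective linear_f) simp_all
  then obtain l where l: "(\<alpha>, \<beta>, \<gamma>) = ?f l" by (rule surjE)
  have "inner l (hom x y z) = \<alpha> * x + \<beta> * y + \<gamma> * z" for x y z
    using l by (subst split) (simp add: inner_add_right)
  then show ?thesis by (rule that)
qed

lemma bary_eq_iff:
  assumes "(x, y, z) \<noteq> (0, 0, 0)" "(x', y', z') \<noteq> (0, 0, 0)"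
  shows "bary A B C x y z = bary A B C x' y' z' \<longleftrightarrow>
    y * z' = z * y' \<and> z * x' = x * z' \<and> x * y' = y * x'" (is "_ \<longleftrightarrow> ?c")
proof -
  have "bary A B C x y z = bary A B C x' y' z' \<longleftrightarrow> (\<exists>k. k \<noteq> 0 \<and> hom x' y' z' = k *\<^sub>R hom x y z)"
    unfolding bary_hom using assms by (intro proj_eq_iff) (simp_all add: hom_eq_0)
  also have "\<dots> \<longleftrightarrow> (\<exists>k. k \<noteq> 0 \<and> x' = k * x \<and> y' = k * y \<and> z' = k * z)"
  proof -
    have "hom x' y' z' = k *\<^sub>R hom x y z \<longleftrightarrow> x' = k * x \<and> y' = k * y \<and> z' = k * z" for k
      using hom_eq_0[of "x' - k * x" "y' - k * y" "z' - k * z"]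
      by (simp add: scale_hom flip: diff_hom)
    then show ?thesis by simp
  qed
  also have "\<dots> \<longleftrightarrow> ?c"
    using proportional_triples[OF assms] by (auto simp: mult.left_commute mult.commute)
  finally show ?thesis .
qed

lemma bary_scale:
  assumes "k \<noteq> 0" shows "bary A B C (k * x) (k * y) (k * z) = bary A B C x y z"
  unfolding bary_hom scale_hom[symmetric] by (rule proj_scale[OF assms])

lemma bary_rotate: "bary B C A y z x = bary A B C x y z"
  by (simp add: bary_def algebra_simps)

lemma ordinary_vertex:
  "ordinary A = bary A B C 1 0 0" "ordinary B = bary A B C 0 1 0" "ordinary C = bary A B C 0 0 1"
  by (simp_all add: ordinary_def bary_def)

lemma bary_ordinary:
  assumes "x + y + z \<noteq> 0"
  shows "bary A B C x y z = ordinary ((1 / (x + y + z)) *\<^sub>R (x *\<^sub>R A + y *\<^sub>R B + z *\<^sub>R C))"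
proof -
  have "bary A B C x y z = proj ((1 / (x + y + z)) *\<^sub>R hom x y z)"
    unfolding bary_hom using assms by (subst proj_scale) auto
  then show ?thesis using assms by (simp add: ordinary_def hom_def)
qed

lemma ext_bary_triangle:
  assumes "affine_map f" "(x, y, z) \<noteq> (0, 0, 0)"
  shows "ext f (bary A B C x y z) = bary (f A) (f B) (f C) x y z"
  using ext_bary[OF assms, of A B C] hom_eq_0[of x y z] assms(2) by (simp add: hom_def)

definition bary_line :: "real \<Rightarrow> real \<Rightarrow> real \<Rightarrow> epoint set" where
  "bary_line \<alpha> \<beta> \<gamma> = {bary A B C x y z | x y z. (x, y, z) \<noteq> (0, 0, 0) \<and> \<alpha> * x + \<beta> * y + \<gamma> * z = 0}"

lemma bary_line_eq_functional:
  assumes "\<And>x y z. inner l (hom x y z) = \<alpha> * x + \<beta> * y + \<gamma> * z"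
  shows "bary_line \<alpha> \<beta> \<gamma> = {X. inner l (coords X) = 0}"
proof (rule set_eqI)
  fix X
  have on: "inner l (coords (bary A B C x y z)) = 0 \<longleftrightarrow> \<alpha> * x + \<beta> * y + \<gamma> * z = 0"
    if "(x, y, z) \<noteq> (0, 0, 0)" for x y z
    unfolding bary_hom using that by (subst proj_on_line) (simp_all add: hom_eq_0 assms)
  obtain x y z where "X = bary A B C x y z" "(x, y, z) \<noteq> (0, 0, 0)" by (rule bary_cases)
  then show "X \<in> bary_line \<alpha> \<beta> \<gamma> \<longleftrightarrow> X \<in> {X. inner l (coords X) = 0}"
    using on unfolding bary_line_def by blast
qed

lemma bary_in_line:
  assumes "(x, y, z) \<noteq> (0, 0, 0)"
  shows "bary A B C x y z \<in> bary_line \<alpha> \<beta> \<gamma> \<longleftrightarrow> \<alpha> * x + \<beta> * y + \<gamma> * z = 0"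
proof -
  obtain l where l: "\<And>x y z. inner l (hom x y z) = \<alpha> * x + \<beta> * y + \<gamma> * z"
    using functional_exists by blast
  show ?thesis unfolding bary_line_eq_functional[OF l] mem_Collect_eq bary_hom
    using assms by (subst proj_on_line) (simp_all add: hom_eq_0 l)
qed

lemma is_line_iff: "is_line L \<longleftrightarrow> (\<exists>\<alpha> \<beta> \<gamma>. (\<alpha>, \<beta>, \<gamma>) \<noteq> (0, 0, 0) \<and> L = bary_line \<alpha> \<beta> \<gamma>)"
proof
  assume "is_line L"
  then obtain l where "l \<noteq> 0" and L: "L = {X. inner l (coords X) = 0}"
    unfolding is_line_def by blast
  define \<alpha> where "\<alpha> = inner l (A, 1)"
  define \<beta> where "\<beta> = inner l (B, 1)"
  define \<gamma> where "\<gamma> = inner l (C, 1)"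
  have l: "inner l (hom x y z) = \<alpha> * x + \<beta> * y + \<gamma> * z" for x y z
    by (simp only: hom_def \<alpha>_def \<beta>_def \<gamma>_def inner_add_right inner_scaleR_right mult.commute)
  have "(\<alpha>, \<beta>, \<gamma>) \<noteq> (0, 0, 0)"
  proof
    assume "(\<alpha>, \<beta>, \<gamma>) = (0, 0, 0)"
    then have "inner l u = 0" for u by (rule_tac hom_cases[of u]) (auto simp: l)
    from this[of l] show False using \<open>l \<noteq> 0\<close> by simp
  qed
  with L bary_line_eq_functional[OF l] show "\<exists>\<alpha> \<beta> \<gamma>. (\<alpha>, \<beta>, \<gamma>) \<noteq> (0, 0, 0) \<and> L = bary_line \<alpha> \<beta> \<gamma>" by metis
next
  assume "\<exists>\<alpha> \<beta> \<gamma>. (\<alpha>, \<beta>, \<gamma>) \<noteq> (0, 0, 0) \<and> L = bary_line \<alpha> \<beta> \<gamma>"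
  then obtain \<alpha> \<beta> \<gamma> where nz: "(\<alpha>, \<beta>, \<gamma>) \<noteq> (0, 0, 0)" and L: "L = bary_line \<alpha> \<beta> \<gamma>" by blast
  obtain l where l: "\<And>x y z. inner l (hom x y z) = \<alpha> * x + \<beta> * y + \<gamma> * z"
    using functional_exists by blast
  have "l \<noteq> 0" using nz l[of 1 0 0] l[of 0 1 0] l[of 0 0 1] by auto
  with L bary_line_eq_functional[OF l] show "is_line L" unfolding is_line_def by blast
qed

lemma bary_line_scale: "k \<noteq> 0 \<Longrightarrow> bary_line (k * \<alpha>) (k * \<beta>) (k * \<gamma>) = bary_line \<alpha> \<beta> \<gamma>"
proof -
  assume "k \<noteq> 0"
  then have "k * \<alpha> * x + k * \<beta> * y + k * \<gamma> * z = 0 \<longleftrightarrow> \<alpha> * x + \<beta> * y + \<gamma> * z = 0" for x y z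
    by (simp add: mult.assoc flip: distrib_left)
  then show ?thesis unfolding bary_line_def by simp
qed

lemma bary_line_rotate: "triangle.bary_line B C A \<beta> \<gamma> \<alpha> = bary_line \<alpha> \<beta> \<gamma>"
proof (rule set_eqI)
  fix X
  obtain x y z where X: "X = bary A B C x y z" and nz: "(x, y, z) \<noteq> (0, 0, 0)" by (rule bary_cases)
  then have "(y, z, x) \<noteq> (0, 0, 0)" by auto
  from triangle.bary_in_line[OF rotate this, of \<beta> \<gamma> \<alpha>]
  show "X \<in> triangle.bary_line B C A \<beta> \<gamma> \<alpha> \<longleftrightarrow> X \<in> bary_line \<alpha> \<beta> \<gamma>"
    unfolding X bary_rotate bary_in_line[OF nz] by (simp add: add_ac)
qed

text \<open>
  A line through two points has a coefficient triple orthogonal to both coordinate triples, hence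
  proportional to their cross product; dually for the common point of two lines.
\<close>

lemma line_through_bary:
  assumes "(\<alpha>, \<beta>, \<gamma>) \<noteq> (0, 0, 0)" "(x, y, z) \<noteq> (0, 0, 0)" "(x', y', z') \<noteq> (0, 0, 0)"
    and "\<alpha> = y * z' - z * y'" "\<beta> = z * x' - x * z'" "\<gamma> = x * y' - y * x'"
  shows "line_through (bary A B C x y z) (bary A B C x' y' z') = bary_line \<alpha> \<beta> \<gamma>"
  unfolding line_through_def
proof (rule the_equality)
  show "is_line (bary_line \<alpha> \<beta> \<gamma>) \<and> bary A B C x y z \<in> bary_line \<alpha> \<beta> \<gamma> \<and> bary A B C x' y' z' \<in> bary_line \<alpha> \<beta> \<gamma>"
    using assms(1) unfolding is_line_iff bary_in_line[OF assms(2)] bary_in_line[OF assms(3)] assms(4-6)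
    by (intro conjI exI[where P = "\<lambda>\<alpha>. \<exists>\<beta> \<gamma>. _ \<alpha> \<beta> \<gamma>"] exI refl) (auto simp: algebra_simps)
next
  fix L
  assume L: "is_line L \<and> bary A B C x y z \<in> L \<and> bary A B C x' y' z' \<in> L"
  then obtain a b c where nz: "(a, b, c) \<noteq> (0, 0, 0)" and L': "L = bary_line a b c"
    unfolding is_line_iff by blast
  have e: "a * x + b * y + c * z = 0" "a * x' + b * y' + c * z' = 0"
    using L unfolding L' by (simp_all only: bary_in_line[OF assms(2)] bary_in_line[OF assms(3)])
  have "\<beta> * c = \<gamma> * b" "\<gamma> * a = \<alpha> * c" "\<alpha> * b = \<beta> * a"
    unfolding assms(4-6) using e by algebra+
  then obtain k where "k \<noteq> 0" "a = k * \<alpha>" "b = k * \<beta>" "c = k * \<gamma>"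
    by (rule proportional_triples[OF assms(1) nz])
  then show "L = bary_line \<alpha> \<beta> \<gamma>" using bary_line_scale L' by simp
qed

lemma bary_lines_meet:
  assumes "(x, y, z) \<noteq> (0, 0, 0)"
    and "x = \<beta> * \<gamma>' - \<gamma> * \<beta>'" "y = \<gamma> * \<alpha>' - \<alpha> * \<gamma>'" "z = \<alpha> * \<beta>' - \<beta> * \<alpha>'"
  shows "bary_line \<alpha> \<beta> \<gamma> \<inter> bary_line \<alpha>' \<beta>' \<gamma>' = {bary A B C x y z}"
proof (rule set_eqI)
  fix X
  obtain u v w where X: "X = bary A B C u v w" and nz: "(u, v, w) \<noteq> (0, 0, 0)" by (rule bary_cases)
  have "X \<in> bary_line \<alpha> \<beta> \<gamma> \<inter> bary_line \<alpha>' \<beta>' \<gamma>' \<longleftrightarrow>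
    \<alpha> * u + \<beta> * v + \<gamma> * w = 0 \<and> \<alpha>' * u + \<beta>' * v + \<gamma>' * w = 0"
    unfolding X Int_iff bary_in_line[OF nz] ..
  also have "\<dots> \<longleftrightarrow> v * z = w * y \<and> w * x = u * z \<and> u * y = v * x" (is "?l \<longleftrightarrow> ?r")
  proof
    show ?r if ?l unfolding assms(2-4) using that by algebra
    show ?l if ?r
    proof -
      have "v * z = w * y" "w * x = u * z" "u * y = v * x" using that by auto
      then obtain k where "u = k * x" "v = k * y" "w = k * z"
        using proportional_triples[OF assms(1) nz] by (metis mult.commute)
      then show ?thesis unfolding assms(2-4) by algebra
    qed
  qed
  also have "\<dots> \<longleftrightarrow> X \<in> {bary A B C x y z}"
    unfolding X by (simp add: bary_eq_iff[OF nz assms(1)])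
  finally show "X \<in> bary_line \<alpha> \<beta> \<gamma> \<inter> bary_line \<alpha>' \<beta>' \<gamma>' \<longleftrightarrow> X \<in> {bary A B C x y z}" .
qed

lemma meet_bary_lines:
  assumes "(x, y, z) \<noteq> (0, 0, 0)"
    and "x = \<beta> * \<gamma>' - \<gamma> * \<beta>'" "y = \<gamma> * \<alpha>' - \<alpha> * \<gamma>'" "z = \<alpha> * \<beta>' - \<beta> * \<alpha>'"
  shows "meet (bary_line \<alpha> \<beta> \<gamma>) (bary_line \<alpha>' \<beta>' \<gamma>') = bary A B C x y z"
  unfolding meet_def using bary_lines_meet[OF assms] by (intro the_equality) blast+

lemma line_BC: "line_through (ordinary B) (ordinary C) = bary_line 1 0 0"
  and line_CA: "line_through (ordinary C) (ordinary A) = bary_line 0 1 0"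
  and line_AB: "line_through (ordinary A) (ordinary B) = bary_line 0 0 1"
  unfolding ordinary_vertex by (rule line_through_bary; simp)+

lemma cevian_foot_bary:
  assumes "(y, z) \<noteq> (0, 0)"
  shows "cevian_foot A B C (bary A B C x y z) = bary A B C 0 y z"
proof -
  have join: "line_through (ordinary A) (bary A B C x y z) = bary_line 0 (- z) y"
    unfolding ordinary_vertex by (rule line_through_bary) (use assms in auto)
  show ?thesis unfolding cevian_foot_def line_BC join
    by (rule meet_bary_lines) (use assms in auto)
qed

end

section \<open>The generalized isogonal image of the centroid\<close>

context triangle begin

lemma ordinary_cases:
  obtains x y z where "(X, 1) = hom x y z" "x + y + z = 1"
  by (metis hom_cases snd_conv snd_hom)

lemma l_inf_eq_bary_line: "l_inf = bary_line 1 1 1"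
proof (rule set_eqI)
  fix X
  obtain x y z where X: "X = bary A B C x y z" and nz: "(x, y, z) \<noteq> (0, 0, 0)" by (rule bary_cases)
  show "X \<in> l_inf \<longleftrightarrow> X \<in> bary_line 1 1 1"
    unfolding X bary_in_line[OF nz] unfolding bary_hom
    using nz by (subst proj_on_l_inf) (simp_all add: hom_eq_0)
qed

text \<open>
  With coordinates normalized to sum 1 this is the identity
  \<open>(X \<times> Y) \<times> (1, 1, 1) = (X \<cdot> 1) Y - (Y \<cdot> 1) X = Y - X\<close>.
\<close>

lemma line_meets_l_inf:
  assumes "X \<noteq> Y"
  shows "line_through (ordinary X) (ordinary Y) \<inter> l_inf = {proj (Y - X, 0)}"
proof -
  obtain x y z where X: "(X, 1) = hom x y z" and s: "x + y + z = 1" by (rule ordinary_cases)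
  obtain x' y' z' where Y: "(Y, 1) = hom x' y' z'" and s': "x' + y' + z' = 1" by (rule ordinary_cases)
  have "(Y - X, 0) = (Y, 1 :: real) - (X, 1)" by simp
  then have d: "(Y - X, 0) = hom (x' - x) (y' - y) (z' - z)" unfolding X Y diff_hom .
  then have nz: "(x' - x, y' - y, z' - z) \<noteq> (0, 0, 0)"
    using assms hom_eq_0[of "x' - x" "y' - y" "z' - z"] by (auto simp: zero_prod_def)
  have nzX: "(x, y, z) \<noteq> (0, 0, 0)" and nzY: "(x', y', z') \<noteq> (0, 0, 0)" using s s' by auto
  let ?\<alpha> = "y * z' - z * y'" and ?\<beta> = "z * x' - x * z'" and ?\<gamma> = "x * y' - y * x'"
  have c: "x' - x = ?\<beta> * 1 - ?\<gamma> * 1" "y' - y = ?\<gamma> * 1 - ?\<alpha> * 1" "z' - z = ?\<alpha> * 1 - ?\<beta> * 1"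
    using s s' by algebra+
  then have "(?\<alpha>, ?\<beta>, ?\<gamma>) \<noteq> (0, 0, 0)" using nz by auto
  then have "line_through (ordinary X) (ordinary Y) = bary_line ?\<alpha> ?\<beta> ?\<gamma>"
    unfolding ordinary_def X Y bary_hom[symmetric]
    using nzX nzY by (intro line_through_bary) simp_all
  then show ?thesis
    unfolding l_inf_eq_bary_line d bary_hom[symmetric] using bary_lines_meet[OF nz c] by simp
qed

lemma parallel_lines_iff:
  assumes "X \<noteq> Y" "e \<noteq> f"
  shows "parallel_lines (line_through (ordinary X) (ordinary Y)) (line_through (ordinary e) (ordinary f))
    \<longleftrightarrow> (\<exists>s. s \<noteq> 0 \<and> Y - X = s *\<^sub>R (f - e))"
proof -
  have "Z \<in> l_inf \<and> Z \<in> line_through (ordinary X') (ordinary Y') \<longleftrightarrow> Z = proj (Y' - X', 0)"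
    if "X' \<noteq> Y'" for X' Y' Z
    using line_meets_l_inf[OF that] by (simp add: set_eq_iff) blast
  then have "parallel_lines (line_through (ordinary X) (ordinary Y)) (line_through (ordinary e) (ordinary f))
    \<longleftrightarrow> proj (f - e, 0) = proj (Y - X, 0)"
    unfolding parallel_lines_def Bex_def using assms by (metis (no_types))
  also have "\<dots> \<longleftrightarrow> (\<exists>s. s \<noteq> 0 \<and> Y - X = s *\<^sub>R (f - e))"
    using assms by (subst proj_eq_iff) (simp_all add: prod_eq_iff)
  finally show ?thesis .
qed

text \<open>
  The image of \<open>X\<close> has the form \<open>X + s (f - e)\<close>, and \<open>l\<close> takes the value
  \<open>l(X) + (s / 2) l(f - e)\<close> at the midpoint.  This vanishes for exactly one \<open>s\<close>
  as the direction \<open>f - e\<close> is not that of the axis.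
\<close>

lemma affine_reflection_eq:
  fixes l :: hvec
  assumes L: "L = {X. inner l (coords X) = 0}"
    and d: "inner l (f - e, 0) \<noteq> 0"
  shows "affine_reflection L (line_through (ordinary e) (ordinary f)) X =
    X - (2 * inner l (X, 1) / inner l (f - e, 0)) *\<^sub>R (f - e)"
proof -
  have "e \<noteq> f" using d by (auto simp: inner_prod_def)
  have on: "ordinary Z \<in> L \<longleftrightarrow> inner l (Z, 1) = 0" for Z
    unfolding L ordinary_def mem_Collect_eq by (rule proj_on_line) (simp add: zero_prod_def)
  have step: "inner l (midpoint X (X + s *\<^sub>R (f - e)), 1) = inner l (X, 1) + s / 2 * inner l (f - e, 0)" for s
  proof -
    have "(midpoint X (X + s *\<^sub>R (f - e)), 1 :: real) = (X, 1) + (s / 2) *\<^sub>R (f - e, 0)"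
      by (simp add: midpoint_def vec_eq_iff field_simps)
    then show ?thesis by (simp only: inner_add_right inner_scaleR_right)
  qed
  have dir: "(X' \<noteq> X \<longrightarrow> parallel_lines (line_through (ordinary X) (ordinary X'))
      (line_through (ordinary e) (ordinary f))) \<longleftrightarrow> (\<exists>s. X' = X + s *\<^sub>R (f - e))" for X'
  proof (cases "X' = X")
    case True
    then show ?thesis by (auto intro: exI[of _ 0])
  next
    case False
    have "(\<exists>s. s \<noteq> 0 \<and> X' - X = s *\<^sub>R (f - e)) \<longleftrightarrow> (\<exists>s. X' = X + s *\<^sub>R (f - e))"
      using False by (metis add.commute add.right_neutral add_diff_cancel_left' diff_add_cancel scaleR_zero_left)
    then show ?thesis using parallel_lines_iff[OF _ \<open>e \<noteq> f\<close>, of X X'] False by simp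
  qed
  show ?thesis
    unfolding affine_reflection_def dir on
  proof (rule the_equality, intro conjI)
    let ?s = "- (2 * inner l (X, 1) / inner l (f - e, 0))"
    have R: "X - (2 * inner l (X, 1) / inner l (f - e, 0)) *\<^sub>R (f - e) = X + ?s *\<^sub>R (f - e)" by simp
    then show "\<exists>s. X - (2 * inner l (X, 1) / inner l (f - e, 0)) *\<^sub>R (f - e) = X + s *\<^sub>R (f - e)" by blast
    show "inner l (midpoint X (X - (2 * inner l (X, 1) / inner l (f - e, 0)) *\<^sub>R (f - e)), 1) = 0"
      unfolding R step using d by simp
  next
    fix X' assume "(\<exists>s. X' = X + s *\<^sub>R (f - e)) \<and> inner l (midpoint X X', 1) = 0"
    then obtain s where s: "X' = X + s *\<^sub>R (f - e)" and m: "inner l (midpoint X X', 1) = 0" by blast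
    from m have "s = - (2 * inner l (X, 1) / inner l (f - e, 0))"
      unfolding s step using d by (simp add: field_simps)
    then show "X' = X - (2 * inner l (X, 1) / inner l (f - e, 0)) *\<^sub>R (f - e)" using s by simp
  qed
qed

lemma affine_map_reflection:
  fixes l :: hvec
  shows "affine_map (\<lambda>X. X - (2 * inner l (X, 1) / \<delta>) *\<^sub>R d)"
proof -
  have "linear (\<lambda>X. X - (2 * inner l (X, 0) / \<delta>) *\<^sub>R d)"
    by (rule linearI) (simp_all add: inner_prod_def inner_add_right algebra_simps add_divide_distrib)
  moreover have "X - (2 * inner l (X, 1) / \<delta>) *\<^sub>R d =
      X - (2 * inner l (X, 0) / \<delta>) *\<^sub>R d + - (2 * snd l / \<delta>) *\<^sub>R d" for X
    by (simp add: inner_prod_def distrib_left add_divide_distrib scaleR_left_distrib)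
  ultimately show ?thesis unfolding affine_map_def by blast
qed

text \<open>
  The axis has the equation \<open>l = - (x + y) v + (z + x) w = 0\<close>.  The displacement \<open>F - E\<close> has
  \<open>l(F - E) = - 2 x\<close>, so for \<open>x \<noteq> 0\<close> its direction is never that of the axis, and
  \<open>l(G) = (z - y) / 3\<close>.  So \<open>G\<close> is moved by \<open>(z - y) / (3 x)\<close> times \<open>F - E\<close>, to a point whose last two
  coordinates are in the ratio \<open>(z + x)\<^sup>2 : (x + y)\<^sup>2\<close>.
\<close>

lemma reflected_centroid_line:
  assumes "x \<noteq> 0" "z + x \<noteq> 0" "x + y \<noteq> 0"
  shows "line_through (ordinary A)
     (ext (affine_reflection
         (line_through (ordinary A) (bary A B C (y + z) (z + x) (x + y)))
         (line_through (bary A B C z 0 x) (bary A B C y x 0)))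
       (ordinary (centroid A B C))) = bary_line 0 (- ((x + y)\<^sup>2)) ((z + x)\<^sup>2)"
proof -
  let ?E = "(1 / (z + x)) *\<^sub>R (z *\<^sub>R A + x *\<^sub>R C)" and ?F = "(1 / (x + y)) *\<^sub>R (y *\<^sub>R A + x *\<^sub>R B)"
  let ?G = "centroid A B C"
  have EF: "bary A B C z 0 x = ordinary ?E" "bary A B C y x 0 = ordinary ?F"
    using bary_ordinary[of z 0 x] bary_ordinary[of y x 0] assms by (simp_all add: add.commute)
  have AQ: "line_through (ordinary A) (bary A B C (y + z) (z + x) (x + y)) = bary_line 0 (- (x + y)) (z + x)"
    unfolding ordinary_vertex by (rule line_through_bary) (use assms in simp_all)
  obtain l where l: "\<And>u v w. inner l (hom u v w) = 0 * u + (- (x + y)) * v + (z + x) * w"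
    using functional_exists by blast
  have d: "(?F - ?E, 0) = hom (y / (x + y) - z / (z + x)) (x / (x + y)) (- (x / (z + x)))"
  proof -
    have "(?E, 1) = hom (z / (z + x)) 0 (x / (z + x))" "(?F, 1) = hom (y / (x + y)) (x / (x + y)) 0"
      using assms by (simp_all add: hom_def scaleR_right_distrib add.commute flip: add_divide_distrib)
    moreover have "(?F - ?E, 0) = (?F, 1 :: real) - (?E, 1)" by simp
    ultimately show ?thesis by (simp only: diff_hom) simp
  qed
  have G: "(?G, 1) = hom (1/3) (1/3) (1/3)"
    by (simp add: hom_def centroid_def algebra_simps)
  have ld: "inner l (?F - ?E, 0) = - 2 * x"
  proof -
    have "(x + y) * (x / (x + y)) = x" "(z + x) * (x / (z + x)) = x" using assms by simp_all
    then show ?thesis unfolding d l by (simp only: mult_minus_left mult_minus_right)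
  qed
  have lG: "inner l (?G, 1) = (z - y) / 3"
    unfolding G l by (simp add: field_simps)
  let ?h = "affine_reflection (bary_line 0 (- (x + y)) (z + x)) (line_through (ordinary ?E) (ordinary ?F))"
  have h: "?h = (\<lambda>X. X - (2 * inner l (X, 1) / inner l (?F - ?E, 0)) *\<^sub>R (?F - ?E))"
    using affine_reflection_eq[OF bary_line_eq_functional[OF l]] ld assms by auto
  have "affine_map ?h" unfolding h by (rule affine_map_reflection)
  then have "ext ?h (ordinary ?G) = ordinary (?h ?G)" by (rule ext_ordinary)
  also have "?h ?G = ?G + ((z - y) / (3 * x)) *\<^sub>R (?F - ?E)"
  proof -
    have "2 * ((z - y) / 3) / (- 2 * x) = - ((z - y) / (3 * x))" using assms by (simp add: field_simps)
    then show ?thesis unfolding h ld lG by simp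
  qed
  also have "ordinary \<dots> = proj ((?G, 1) + ((z - y) / (3 * x)) *\<^sub>R (?F - ?E, 0))"
    by (simp add: ordinary_def)
  also have "\<dots> = bary A B C (1/3 + (z - y) / (3 * x) * (y / (x + y) - z / (z + x)))
      ((z + x) / (3 * (x + y))) ((x + y) / (3 * (z + x)))"
  proof -
    have "(z - y) / (3 * x) * (x / (x + y)) = (z - y) / (3 * (x + y))"
      "(z - y) / (3 * x) * - (x / (z + x)) = - ((z - y) / (3 * (z + x)))"
      using assms by simp_all
    moreover have "1/3 + (z - y) / (3 * (x + y)) = (z + x) / (3 * (x + y))"
      "1/3 + - ((z - y) / (3 * (z + x))) = (x + y) / (3 * (z + x))"
      using assms by (simp_all add: field_simps)
    ultimately show ?thesis unfolding d G scale_hom add_hom bary_hom by (simp only:)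
  qed
  finally have image: "ext ?h (ordinary ?G) = bary A B C (1/3 + (z - y) / (3 * x) * (y / (x + y) - z / (z + x)))
      ((z + x) / (3 * (x + y))) ((x + y) / (3 * (z + x)))" .
  have "line_through (ordinary A) (ext ?h (ordinary ?G)) =
      bary_line 0 (- ((x + y) / (3 * (z + x)))) ((z + x) / (3 * (x + y)))"
    unfolding image ordinary_vertex(1) by (rule line_through_bary) (use assms in simp_all)
  also have "\<dots> = bary_line 0 (- ((x + y)\<^sup>2)) ((z + x)\<^sup>2)"
  proof -
    have "3 * (x + y) * (z + x) \<noteq> 0" using assms by simp
    from bary_line_scale[OF this, of 0 "- ((x + y) / (3 * (z + x)))" "(z + x) / (3 * (x + y))"]
    moreover have "3 * (x + y) * (z + x) * - ((x + y) / (3 * (z + x))) = - ((x + y)\<^sup>2)"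
      "3 * (x + y) * (z + x) * ((z + x) / (3 * (x + y))) = (z + x)\<^sup>2"
      using assms by (simp_all add: divide_simps) (simp_all add: power2_eq_square algebra_simps)
    ultimately show ?thesis by (simp only: mult_zero_right)
  qed
  finally show ?thesis unfolding AQ EF .
qed

lemma cevian_lines_meet:
  assumes "a \<noteq> 0" "b \<noteq> 0" "c \<noteq> 0"
  shows "bary_line 0 (- c) b \<inter> bary_line c 0 (- a) \<inter> bary_line (- b) a 0 = {bary A B C a b c}"
proof -
  have "bary_line 0 (- c) b \<inter> bary_line c 0 (- a) = {bary A B C (c * a) (c * b) (c * c)}"
    by (rule bary_lines_meet) (use assms in simp_all)
  also have "bary A B C (c * a) (c * b) (c * c) = bary A B C a b c" using assms by (intro bary_scale)
  finally show ?thesis using assms by (auto simp: bary_in_line)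
qed

lemma isotomic_bary:
  assumes "x \<noteq> 0" "y \<noteq> 0" "z \<noteq> 0"
  shows "isotomic A B C (bary A B C (y * z) (z * x) (x * y)) = bary A B C x y z"
  unfolding isotomic_def
proof (rule the_equality)
  have "bary A B C (1 / (y * z)) (1 / (z * x)) (1 / (x * y)) = bary A B C x y z"
    using assms by (subst bary_eq_iff) (simp_all add: field_simps)
  then show "\<exists>p q r. p \<noteq> 0 \<and> q \<noteq> 0 \<and> r \<noteq> 0 \<and>
      bary A B C (y * z) (z * x) (x * y) = bary A B C p q r \<and>
      bary A B C x y z = bary A B C (1 / p) (1 / q) (1 / r)"
    using assms by (intro exI[of _ "y * z"] exI[of _ "z * x"] exI[of _ "x * y"]) simp
next
  fix Y
  assume "\<exists>p q r. p \<noteq> 0 \<and> q \<noteq> 0 \<and> r \<noteq> 0 \<and>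
      bary A B C (y * z) (z * x) (x * y) = bary A B C p q r \<and> Y = bary A B C (1 / p) (1 / q) (1 / r)"
  then obtain p q r where nz: "p \<noteq> 0" "q \<noteq> 0" "r \<noteq> 0"
    and eq: "bary A B C (y * z) (z * x) (x * y) = bary A B C p q r"
    and Y: "Y = bary A B C (1 / p) (1 / q) (1 / r)" by blast
  have "(y * z, z * x, x * y) \<noteq> (0, 0, 0)" "(p, q, r) \<noteq> (0, 0, 0)" using assms nz by simp_all
  from eq[unfolded bary_eq_iff[OF this]]
  have "x * (z * r) = x * (y * q)" "y * (x * p) = y * (z * r)" by (simp_all only: mult_ac)
  then have "z * r = y * q" "x * p = z * r" using assms by simp_all
  then have "1 / q * z = 1 / r * y" "1 / r * x = 1 / p * z" "1 / p * y = 1 / q * x"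
    using nz by (simp_all add: frac_eq_eq)
  then show "Y = bary A B C x y z"
    unfolding Y using assms nz by (subst bary_eq_iff) simp_all
qed

lemma complement_bary:
  assumes "(x, y, z) \<noteq> (0, 0, 0)"
  shows "ext (complement_map A B C) (bary A B C x y z) = bary A B C (y + z) (z + x) (x + y)"
proof -
  have "affine_map (complement_map A B C)"
    unfolding affine_map_def
    by (intro exI[of _ "\<lambda>X. (- 1/2) *\<^sub>R X"] exI[of _ "(3/2) *\<^sub>R centroid A B C"] conjI linearI ext)
      (simp_all add: complement_map_def vec_eq_iff field_simps)
  then have "ext (complement_map A B C) (bary A B C x y z) =
      bary (complement_map A B C A) (complement_map A B C B) (complement_map A B C C) x y z"
    using assms by (rule ext_bary_triangle)
  also have "\<dots> = proj ((1/2) *\<^sub>R hom (y + z) (z + x) (x + y))"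
    unfolding bary_def hom_def complement_map_def centroid_def
    by (rule arg_cong[where f = proj]) (simp add: vec_eq_iff field_simps)
  also have "\<dots> = bary A B C (y + z) (z + x) (x + y)" unfolding bary_hom by (rule proj_scale) simp
  finally show ?thesis .
qed

lemma gen_isogonal_centroid:
  assumes nz: "x \<noteq> 0" "y \<noteq> 0" "z \<noteq> 0" and s: "y + z \<noteq> 0" "z + x \<noteq> 0" "x + y \<noteq> 0"
  shows "gen_isogonal A B C (bary A B C (y * z) (z * x) (x * y)) (ordinary (centroid A B C)) =
    bary A B C ((y + z)\<^sup>2) ((z + x)\<^sup>2) ((x + y)\<^sup>2)"
proof -
  interpret B: triangle B C A by (rule rotate)
  interpret C: triangle C A B by (rule B.rotate)
  let ?P = "bary A B C (y * z) (z * x) (x * y)"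
  let ?Q = "bary A B C (y + z) (z + x) (x + y)"
  have Q: "Q_point A B C ?P = ?Q"
    unfolding Q_point_def isotomic_bary[OF nz] using nz by (simp add: complement_bary)
  have G: "centroid B C A = centroid A B C" "centroid C A B = centroid A B C"
    by (simp_all add: centroid_def add_ac)
  have rot: "bary B C A v w u = bary A B C u v w" "bary C A B w u v = bary A B C u v w" for u v w
    by (simp_all add: bary_rotate B.bary_rotate)
  have D: "cevian_foot A B C ?P = bary A B C 0 z y"
    using cevian_foot_bary[of "z * x" "x * y" "y * z"] bary_scale[of x 0 z y] nz
    by (simp add: mult.commute)
  have E: "cevian_foot B C A ?P = bary A B C z 0 x"
    using B.cevian_foot_bary[of "x * y" "y * z" "z * x"] bary_scale[of y z 0 x] nz
    by (simp add: mult.commute rot)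
  have F: "cevian_foot C A B ?P = bary A B C y x 0"
    using C.cevian_foot_bary[of "y * z" "z * x" "x * y"] bary_scale[of z y x 0] nz
    by (simp add: mult.commute rot)
  let ?a = "(y + z)\<^sup>2" and ?b = "(z + x)\<^sup>2" and ?c = "(x + y)\<^sup>2"
  have 1: "line_through (ordinary A) (ext (affine_reflection (line_through (ordinary A) ?Q)
      (line_through (bary A B C z 0 x) (bary A B C y x 0))) (ordinary (centroid A B C))) = bary_line 0 (- ?c) ?b"
    using nz s by (intro reflected_centroid_line)
  have 2: "line_through (ordinary B) (ext (affine_reflection (line_through (ordinary B) ?Q)
      (line_through (bary A B C 0 z y) (bary A B C y x 0))) (ordinary (centroid A B C))) = bary_line ?c 0 (- ?a)"
    using B.reflected_centroid_line[of y x z] nz s line_through_commute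
    by (simp add: rot G bary_line_rotate add_ac)
  have 3: "line_through (ordinary C) (ext (affine_reflection (line_through (ordinary C) ?Q)
      (line_through (bary A B C 0 z y) (bary A B C z 0 x))) (ordinary (centroid A B C))) = bary_line (- ?b) ?a 0"
    using C.reflected_centroid_line[of z y x] nz s
    by (simp add: rot G bary_line_rotate B.bary_line_rotate add_ac)
  have meet: "bary_line 0 (- ?c) ?b \<inter> bary_line ?c 0 (- ?a) \<inter> bary_line (- ?b) ?a 0 = {bary A B C ?a ?b ?c}"
    using s by (intro cevian_lines_meet) simp_all
  then show ?thesis
    unfolding gen_isogonal_def Let_def Q D E F 1 2 3 by (intro the_equality) blast+
qed

end

section \<open>The nine-point conic\<close>

text \<open>
  The existence of a suitable conic is a homogeneous system of three equations in its three
  coefficients; stating the criterion as an equivalence covers all degenerate cases at once.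
\<close>

lemma det3_zero_iff:
  fixes a1 :: real
  shows "(\<exists>f g k. (f, g, k) \<noteq> (0, 0, 0) \<and> a1 * f + b1 * g + c1 * k = 0 \<and>
      a2 * f + b2 * g + c2 * k = 0 \<and> a3 * f + b3 * g + c3 * k = 0) \<longleftrightarrow>
    a1 * (b2 * c3 - c2 * b3) - b1 * (a2 * c3 - c2 * a3) + c1 * (a2 * b3 - b2 * a3) = 0"
    (is "?sol \<longleftrightarrow> ?det = 0")
proof -
  let ?M = "vector [vector [a1, b1, c1], vector [a2, b2, c2], vector [a3, b3, c3]] :: real^3^3"
  have "det ?M = ?det" by (simp add: det_3 algebra_simps)
  moreover have "det ?M = 0 \<longleftrightarrow> (\<exists>v. v \<noteq> 0 \<and> ?M *v v = 0)"
    using invertible_det_nz[of ?M] invertible_left_inverse[of ?M] matrix_left_invertible_ker[of ?M] by blast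
  moreover have "(\<exists>v. v \<noteq> 0 \<and> ?M *v v = 0) \<longleftrightarrow> ?sol"
  proof
    assume "\<exists>v. v \<noteq> 0 \<and> ?M *v v = 0"
    then obtain v where "v \<noteq> 0" "?M *v v = 0" by blast
    then show ?sol
      by (intro exI[of _ "v $ 1"] exI[of _ "v $ 2"] exI[of _ "v $ 3"])
        (auto simp: vec_eq_iff forall_3 matrix_vector_mult_def sum_3)
  next
    assume ?sol
    then obtain f g k where "(f, g, k) \<noteq> (0, 0, 0)" "a1 * f + b1 * g + c1 * k = 0"
      "a2 * f + b2 * g + c2 * k = 0" "a3 * f + b3 * g + c3 * k = 0" by blast
    then show "\<exists>v. v \<noteq> 0 \<and> ?M *v v = 0"
      by (intro exI[of _ "vector [f, g, k]"])
        (auto simp: vec_eq_iff forall_3 matrix_vector_mult_def sum_3)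
  qed
  ultimately show ?thesis by simp
qed

lemma proj_in_conic_points:
  assumes "bilinear h" "u \<noteq> 0"
  shows "proj u \<in> conic_points h \<longleftrightarrow> h u u = 0"
  by (rule coords_proj[OF assms(2)])
    (auto simp: conic_points_def bilinear_lmul[OF assms(1)] bilinear_rmul[OF assms(1)])

lemma pole_of_l_inf:
  assumes h: "bilinear h" and "u \<noteq> 0"
  shows "is_pole h (proj u) l_inf \<longleftrightarrow> (\<forall>v. snd v = 0 \<longrightarrow> h u v = 0)"
proof -
  obtain k where k: "k \<noteq> 0" "coords (proj u) = k *\<^sub>R u" using coords_proj[OF assms(2)] .
  have "is_pole h (proj u) l_inf \<longleftrightarrow> (\<forall>Y \<in> l_inf. h u (coords Y) = 0)"
    unfolding is_pole_def k(2) using k(1) by (simp add: bilinear_lmul[OF h])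
  also have "\<dots> \<longleftrightarrow> (\<forall>v. snd v = 0 \<longrightarrow> h u v = 0)"
  proof safe
    fix v :: hvec assume all: "\<forall>Y \<in> l_inf. h u (coords Y) = 0" and "snd v = 0"
    show "h u v = 0"
    proof (cases "v = 0")
      case False
      then obtain c where "c \<noteq> 0" "coords (proj v) = c *\<^sub>R v" by (rule coords_proj)
      moreover have "proj v \<in> l_inf" using False \<open>snd v = 0\<close> by (simp add: proj_on_l_inf)
      ultimately show ?thesis using all by (metis bilinear_rmul[OF h] scaleR_eq_0_iff)
    qed (simp add: bilinear_rzero[OF h])
  qed (simp add: l_inf_def del: split_paired_All)
  finally show ?thesis .
qed

context triangle begin

lemma circumconic_form_expand:
  assumes h: "bilinear h" and sym: "\<And>p q. h p q = h q p"
    and ABC: "h (hom 1 0 0) (hom 1 0 0) = 0" "h (hom 0 1 0) (hom 0 1 0) = 0" "h (hom 0 0 1) (hom 0 0 1) = 0"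
  shows "h (hom u v w) (hom u' v' w') =
    h (hom 0 1 0) (hom 0 0 1) * (v * w' + w * v') + h (hom 0 0 1) (hom 1 0 0) * (w * u' + u * w') +
    h (hom 1 0 0) (hom 0 1 0) * (u * v' + v * u')"
proof -
  have split: "hom x y z = x *\<^sub>R hom 1 0 0 + y *\<^sub>R hom 0 1 0 + z *\<^sub>R hom 0 0 1" for x y z
    by (simp add: hom_def)
  have "h (hom u v w) (hom u' v' w') =
    h (u *\<^sub>R hom 1 0 0 + v *\<^sub>R hom 0 1 0 + w *\<^sub>R hom 0 0 1)
      (u' *\<^sub>R hom 1 0 0 + v' *\<^sub>R hom 0 1 0 + w' *\<^sub>R hom 0 0 1)"
    using split by metis
  also have "\<dots> = h (hom 0 1 0) (hom 0 0 1) * (v * w' + w * v') + h (hom 0 0 1) (hom 1 0 0) * (w * u' + u * w') +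
    h (hom 1 0 0) (hom 0 1 0) * (u * v' + v * u')"
    unfolding bilinear_ladd[OF h] bilinear_radd[OF h] bilinear_lmul[OF h] bilinear_rmul[OF h] ABC
      sym[of "hom 0 0 1" "hom 0 1 0"] sym[of "hom 1 0 0" "hom 0 0 1"] sym[of "hom 0 1 0" "hom 1 0 0"]
    by (simp add: algebra_simps)
  finally show ?thesis .
qed

lemma circumconic_form_exists:
  fixes f g k :: real
  assumes "(f, g, k) \<noteq> (0, 0, 0)"
  obtains h where "conic_form h"
    "\<And>u v w u' v' w'. h (hom u v w) (hom u' v' w') =
      f * (v * w' + w * v') + g * (w * u' + u * w') + k * (u * v' + v * u')"
proof -
  obtain l1 where l1: "\<And>x y z. inner l1 (hom x y z) = 1 * x + 0 * y + 0 * z" using functional_exists by blast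
  obtain l2 where l2: "\<And>x y z. inner l2 (hom x y z) = 0 * x + 1 * y + 0 * z" using functional_exists by blast
  obtain l3 where l3: "\<And>x y z. inner l3 (hom x y z) = 0 * x + 0 * y + 1 * z" using functional_exists by blast
  define h where "h p q = f * (inner l2 p * inner l3 q + inner l3 p * inner l2 q) +
    g * (inner l3 p * inner l1 q + inner l1 p * inner l3 q) +
    k * (inner l1 p * inner l2 q + inner l2 p * inner l1 q)" for p q
  have h: "h (hom u v w) (hom u' v' w') =
      f * (v * w' + w * v') + g * (w * u' + u * w') + k * (u * v' + v * u')" for u v w u' v' w'
    by (simp add: h_def l1 l2 l3)
  have "bilinear h" unfolding bilinear_def
    by (intro conjI allI linearI) (simp_all add: h_def inner_add_right algebra_simps)
  moreover have "h p q = h q p" for p q by (simp add: h_def algebra_simps)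
  moreover have "\<exists>p q. h p q \<noteq> 0"
    using assms h[of 0 1 0 0 0 1] h[of 0 0 1 1 0 0] h[of 1 0 0 0 1 0] by fastforce
  ultimately have "conic_form h" by (simp add: conic_form_def)
  with h show ?thesis using that by blast
qed

text \<open>
  Conjugacy to the line at infinity is tested on its points \<open>B - C\<close> and \<open>A - C\<close>.  Together with the
  incidence of \<open>(x : y : z)\<close> this gives three linear equations for the coefficients \<open>f, g, k\<close>, and the
  left-hand side of the equation below is, up to sign, their determinant.
\<close>

lemma nine_point_conic_bary:
  assumes nz: "(x, y, z) \<noteq> (0, 0, 0)" and uvw: "(u, v, w) \<noteq> (0, 0, 0)"
  shows "bary A B C u v w \<in> nine_point_conic (ordinary A) (ordinary B) (ordinary C) (bary A B C x y z) \<longleftrightarrow>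
    y * z * u * (v + w - u) + z * x * v * (w + u - v) + x * y * w * (u + v - w) = 0"
proof -
  define good where "good f g k \<longleftrightarrow> (w - v) * f + (- u) * g + u * k = 0 \<and> (- v) * f + (w - u) * g + v * k = 0 \<and>
    (y * z) * f + (z * x) * g + (x * y) * k = 0" for f g k
  have pole: "is_pole h (bary A B C u v w) l_inf \<and> bary A B C x y z \<in> conic_points h \<longleftrightarrow> good f g k"
    if h: "bilinear h" and e: "\<And>u v w u' v' w'. h (hom u v w) (hom u' v' w') =
      f * (v * w' + w * v') + g * (w * u' + u * w') + k * (u * v' + v * u')" for h f g k
  proof -
    have "bary A B C x y z \<in> conic_points h \<longleftrightarrow> 2 * ((y * z) * f + (z * x) * g + (x * y) * k) = 0"
    proof -
      have "f * (y * z + z * y) + g * (z * x + x * z) + k * (x * y + y * x) =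
        2 * ((y * z) * f + (z * x) * g + (x * y) * k)" by (simp add: algebra_simps)
      then show ?thesis
        unfolding bary_hom using nz by (subst proj_in_conic_points[OF h]) (simp_all only: hom_eq_0 e not_False_eq_True)
    qed
    moreover have "is_pole h (bary A B C u v w) l_inf \<longleftrightarrow>
      (\<forall>u' v' w'. u' + v' + w' = 0 \<longrightarrow> h (hom u v w) (hom u' v' w') = 0)"
    proof -
      have "hom u v w \<noteq> 0" using uvw unfolding hom_eq_0 .
      then have "is_pole h (bary A B C u v w) l_inf \<longleftrightarrow> (\<forall>q. snd q = 0 \<longrightarrow> h (hom u v w) q = 0)"
        unfolding bary_hom by (rule pole_of_l_inf[OF h])
      also have "\<dots> \<longleftrightarrow> (\<forall>u' v' w'. u' + v' + w' = 0 \<longrightarrow> h (hom u v w) (hom u' v' w') = 0)"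
      proof (intro iffI allI impI)
        fix q :: hvec
        assume all: "\<forall>u' v' w'. u' + v' + w' = 0 \<longrightarrow> h (hom u v w) (hom u' v' w') = 0" and "snd q = 0"
        obtain u' v' w' where "q = hom u' v' w'" by (rule hom_cases)
        then show "h (hom u v w) q = 0" using all \<open>snd q = 0\<close> by simp
      next
        fix u' v' w' :: real
        assume "\<forall>q. snd q = 0 \<longrightarrow> h (hom u v w) q = 0" "u' + v' + w' = 0"
        then show "h (hom u v w) (hom u' v' w') = 0" using snd_hom by metis
      qed
      finally show ?thesis .
    qed
    moreover have "\<dots> \<longleftrightarrow> (w - v) * f + (- u) * g + u * k = 0 \<and> (- v) * f + (w - u) * g + v * k = 0"
    proof
      assume all: "\<forall>u' v' w'. u' + v' + w' = 0 \<longrightarrow> h (hom u v w) (hom u' v' w') = 0"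
      then have "h (hom u v w) (hom 0 1 (- 1)) = 0" "h (hom u v w) (hom 1 0 (- 1)) = 0" by simp_all
      then show "(w - v) * f + (- u) * g + u * k = 0 \<and> (- v) * f + (w - u) * g + v * k = 0"
        unfolding e by (simp add: algebra_simps)
    next
      assume E: "(w - v) * f + (- u) * g + u * k = 0 \<and> (- v) * f + (w - u) * g + v * k = 0"
      show "\<forall>u' v' w'. u' + v' + w' = 0 \<longrightarrow> h (hom u v w) (hom u' v' w') = 0"
      proof (intro allI impI)
        fix u' v' w' :: real assume "u' + v' + w' = 0"
        then have w': "w' = - u' - v'" by simp
        have "h (hom u v w) (hom u' v' w') =
          v' * ((w - v) * f + (- u) * g + u * k) + u' * ((- v) * f + (w - u) * g + v * k)"
          unfolding e w' by (simp add: algebra_simps)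
        then show "h (hom u v w) (hom u' v' w') = 0" using E by simp
      qed
    qed
    ultimately show ?thesis unfolding good_def by auto
  qed
  have vertices: "{ordinary A, ordinary B, ordinary C} \<subseteq> conic_points h \<longleftrightarrow>
    h (hom 1 0 0) (hom 1 0 0) = 0 \<and> h (hom 0 1 0) (hom 0 1 0) = 0 \<and> h (hom 0 0 1) (hom 0 0 1) = 0"
    if "bilinear h" for h
    unfolding ordinary_vertex bary_hom by (simp add: proj_in_conic_points[OF that] hom_eq_0)
  have "bary A B C u v w \<in> nine_point_conic (ordinary A) (ordinary B) (ordinary C) (bary A B C x y z) \<longleftrightarrow>
    (\<exists>f g k. (f, g, k) \<noteq> (0, 0, 0) \<and> good f g k)"
  proof
    assume "bary A B C u v w \<in> nine_point_conic (ordinary A) (ordinary B) (ordinary C) (bary A B C x y z)"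
    then obtain h where c: "conic_form h"
      and ABC: "{ordinary A, ordinary B, ordinary C} \<subseteq> conic_points h"
      and P: "bary A B C x y z \<in> conic_points h" and pl: "is_pole h (bary A B C u v w) l_inf"
      unfolding nine_point_conic_def by auto
    have h: "bilinear h" and sym: "\<And>p q. h p q = h q p" using c by (auto simp: conic_form_def)
    let ?f = "h (hom 0 1 0) (hom 0 0 1)" and ?g = "h (hom 0 0 1) (hom 1 0 0)" and ?k = "h (hom 1 0 0) (hom 0 1 0)"
    have e: "h (hom u v w) (hom u' v' w') =
      ?f * (v * w' + w * v') + ?g * (w * u' + u * w') + ?k * (u * v' + v * u')" for u v w u' v' w'
      using ABC unfolding vertices[OF h] by (intro circumconic_form_expand h sym) blast+
    have "(?f, ?g, ?k) \<noteq> (0, 0, 0)"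
    proof
      assume "(?f, ?g, ?k) = (0, 0, 0)"
      then have z: "?f = 0" "?g = 0" "?k = 0" by simp_all
      have "h p q = 0" for p q
      proof -
        obtain u v w where p: "p = hom u v w" by (rule hom_cases)
        obtain u' v' w' where q: "q = hom u' v' w'" by (rule hom_cases)
        show ?thesis unfolding p q by (subst e) (simp only: z mult_zero_left add_0)
      qed
      then show False using c by (simp add: conic_form_def)
    qed
    moreover have "good ?f ?g ?k" using pole[OF h e] pl P by blast
    ultimately show "\<exists>f g k. (f, g, k) \<noteq> (0, 0, 0) \<and> good f g k" by blast
  next
    assume "\<exists>f g k. (f, g, k) \<noteq> (0, 0, 0) \<and> good f g k"
    then obtain f g k where fgk: "(f, g, k) \<noteq> (0, 0, 0)" "good f g k" by blast
    obtain h where c: "conic_form h" and e: "\<And>u v w u' v' w'. h (hom u v w) (hom u' v' w') =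
      f * (v * w' + w * v') + g * (w * u' + u * w') + k * (u * v' + v * u')"
      using circumconic_form_exists[OF fgk(1)] by blast
    have h: "bilinear h" using c by (simp add: conic_form_def)
    have "{ordinary A, ordinary B, ordinary C} \<subseteq> conic_points h"
      unfolding vertices[OF h] by (simp add: e)
    then show "bary A B C u v w \<in> nine_point_conic (ordinary A) (ordinary B) (ordinary C) (bary A B C x y z)"
      using c pole[OF h e] fgk(2) unfolding nine_point_conic_def by blast
  qed
  also have "\<dots> \<longleftrightarrow> (w - v) * ((w - u) * (x * y) - v * (z * x)) - (- u) * ((- v) * (x * y) - v * (y * z)) +
      u * ((- v) * (z * x) - (w - u) * (y * z)) = 0"
    unfolding good_def by (rule det3_zero_iff)
  also have "(w - v) * ((w - u) * (x * y) - v * (z * x)) - (- u) * ((- v) * (x * y) - v * (y * z)) +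
      u * ((- v) * (z * x) - (w - u) * (y * z)) =
    - (y * z * u * (v + w - u) + z * x * v * (w + u - v) + x * y * w * (u + v - w))"
    by (simp add: algebra_simps)
  finally show ?thesis by (simp only: neg_equal_0_iff_equal)
qed

end

section \<open>The circumconic as the preimage of the nine-point conic\<close>

context triangle begin

lemma affine_map_exists:
  obtains f where "affine_map f" "f A = D" "f B = E" "f C = F"
proof -
  obtain l1 where l1: "\<And>x y z. inner l1 (hom x y z) = 1 * x + 0 * y + 0 * z" using functional_exists by blast
  obtain l2 where l2: "\<And>x y z. inner l2 (hom x y z) = 0 * x + 1 * y + 0 * z" using functional_exists by blast
  obtain l3 where l3: "\<And>x y z. inner l3 (hom x y z) = 0 * x + 0 * y + 1 * z" using functional_exists by blast
  define f where "f X = inner l1 (X, 1) *\<^sub>R D + inner l2 (X, 1) *\<^sub>R E + inner l3 (X, 1) *\<^sub>R F" for X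
  have v: "(A, 1) = hom 1 0 0" "(B, 1) = hom 0 1 0" "(C, 1) = hom 0 0 1" by (simp_all add: hom_def)
  have "affine_map f" unfolding affine_map_def
  proof (intro exI conjI)
    show "linear (\<lambda>X. inner l1 (X, 0) *\<^sub>R D + inner l2 (X, 0) *\<^sub>R E + inner l3 (X, 0) *\<^sub>R F)"
      by (rule linearI) (simp_all add: inner_prod_def inner_add_right algebra_simps)
    show "f = (\<lambda>X. inner l1 (X, 0) *\<^sub>R D + inner l2 (X, 0) *\<^sub>R E + inner l3 (X, 0) *\<^sub>R F +
        (snd l1 *\<^sub>R D + snd l2 *\<^sub>R E + snd l3 *\<^sub>R F))"
      by (rule ext) (simp add: f_def inner_prod_def algebra_simps)
  qed
  then show ?thesis by (rule that) (simp_all add: f_def v l1 l2 l3)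
qed

lemma affine_map_unique:
  assumes "affine_map f" "affine_map g" "f A = g A" "f B = g B" "f C = g C"
  shows "f = g"
proof (rule HOL.ext)
  have comb: "k X = x *\<^sub>R k A + y *\<^sub>R k B + z *\<^sub>R k C"
    if "affine_map k" "X = x *\<^sub>R A + y *\<^sub>R B + z *\<^sub>R C" "x + y + z = 1" for k X x y z
  proof -
    obtain L b where L: "linear L" and k: "k = (\<lambda>X. L X + b)"
      using \<open>affine_map k\<close> unfolding affine_map_def by blast
    interpret L: linear L by fact
    have "L X + b = L X + (x + y + z) *\<^sub>R b" using that(3) by simp
    then show ?thesis unfolding k that(2) by (simp add: L.add L.scale algebra_simps)
  qed
  fix X
  obtain x y z where "(X, 1) = hom x y z" "x + y + z = 1" by (rule ordinary_cases)
  then have "X = x *\<^sub>R A + y *\<^sub>R B + z *\<^sub>R C" "x + y + z = 1" by (simp_all add: hom_def)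
  from comb[OF assms(1) this] comb[OF assms(2) this] show "f X = g X" using assms(3-5) by simp
qed

lemma cevian_map_bary:
  assumes s: "y + z \<noteq> 0" "z + x \<noteq> 0" "x + y \<noteq> 0" and uvw: "(u, v, w) \<noteq> (0, 0, 0)"
  defines "U \<equiv> u / (y + z)" and "V \<equiv> v / (z + x)" and "W \<equiv> w / (x + y)"
  shows "ext (cevian_map A B C (bary A B C x y z)) (bary A B C u v w) =
    bary A B C (x * (V + W)) (y * (W + U)) (z * (U + V))"
proof -
  interpret B: triangle B C A by (rule rotate)
  interpret C: triangle C A B by (rule B.rotate)
  have rot: "bary B C A v w u = bary A B C u v w" "bary C A B w u v = bary A B C u v w" for u v w
    by (simp_all add: bary_rotate B.bary_rotate)
  let ?P = "bary A B C x y z"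
  define D where "D = (1 / (y + z)) *\<^sub>R (y *\<^sub>R B + z *\<^sub>R C)"
  define E where "E = (1 / (z + x)) *\<^sub>R (z *\<^sub>R C + x *\<^sub>R A)"
  define F where "F = (1 / (x + y)) *\<^sub>R (x *\<^sub>R A + y *\<^sub>R B)"
  have D: "cevian_foot A B C ?P = ordinary D"
    using cevian_foot_bary[of y z x] bary_ordinary[of 0 y z] s by (auto simp: D_def)
  have E: "cevian_foot B C A ?P = ordinary E"
    using B.cevian_foot_bary[of z x y] B.bary_ordinary[of 0 z x] s by (auto simp: E_def rot)
  have F: "cevian_foot C A B ?P = ordinary F"
    using C.cevian_foot_bary[of x y z] C.bary_ordinary[of 0 x y] s by (auto simp: F_def rot)
  obtain f where f: "affine_map f" "f A = D" "f B = E" "f C = F" by (rule affine_map_exists)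
  have "cevian_map A B C ?P = f"
    unfolding cevian_map_def D E F ordinary_eq_iff
    by (rule the_equality) (use f affine_map_unique in auto)
  then have "ext (cevian_map A B C ?P) (bary A B C u v w) = bary D E F u v w"
    using ext_bary_triangle[OF f(1) uvw] f by simp
  also have "u *\<^sub>R (D, 1) + v *\<^sub>R (E, 1) + w *\<^sub>R (F, 1) =
    U *\<^sub>R hom 0 y z + V *\<^sub>R hom x 0 z + W *\<^sub>R hom x y 0"
  proof -
    have "u *\<^sub>R (D, 1) = U *\<^sub>R hom 0 y z" "v *\<^sub>R (E, 1) = V *\<^sub>R hom x 0 z" "w *\<^sub>R (F, 1) = W *\<^sub>R hom x y 0"
      using s by (simp_all add: U_def V_def W_def D_def E_def F_def hom_def add_ac)
    then show ?thesis by simp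
  qed
  then have "bary D E F u v w = bary A B C (x * (V + W)) (y * (W + U)) (z * (U + V))"
    unfolding bary_def[of D] bary_hom scale_hom add_hom
    by (simp add: algebra_simps)
  finally show ?thesis .
qed

text \<open>
  In terms of \<open>U = u / (y + z)\<close>, \<open>V = v / (z + x)\<close>, \<open>W = w / (x + y)\<close> the preimage has the equation
  \<open>x U (V + W) + y V (W + U) + z W (U + V) = 0\<close>.  Here \<open>V W\<close> has the coefficient \<open>y + z\<close>, and
  substituting back turns it into \<open>(y + z)\<^sup>2\<close> for \<open>v w\<close> after clearing denominators.
\<close>

lemma circumconic_O_bary:
  assumes nz: "x \<noteq> 0" "y \<noteq> 0" "z \<noteq> 0" and s: "y + z \<noteq> 0" "z + x \<noteq> 0" "x + y \<noteq> 0"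
    and uvw: "(u, v, w) \<noteq> (0, 0, 0)"
  shows "bary A B C u v w \<in> circumconic_O A B C (bary A B C (y * z) (z * x) (x * y)) \<longleftrightarrow>
    (y + z)\<^sup>2 * v * w + (z + x)\<^sup>2 * w * u + (x + y)\<^sup>2 * u * v = 0"
proof -
  define U where "U = u / (y + z)"
  define V where "V = v / (z + x)"
  define W where "W = w / (x + y)"
  have uvw_eq: "u = U * (y + z)" "v = V * (z + x)" "w = W * (x + y)" using s by (simp_all add: U_def V_def W_def)
  have image_nz: "(x * (V + W), y * (W + U), z * (U + V)) \<noteq> (0, 0, 0)"
  proof
    assume "(x * (V + W), y * (W + U), z * (U + V)) = (0, 0, 0)"
    then have "V + W = 0" "W + U = 0" "U + V = 0" using nz by simp_all
    then have "U = 0" "V = 0" "W = 0" by linarith+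
    then show False using uvw uvw_eq by simp
  qed
  have "bary A B C u v w \<in> circumconic_O A B C (bary A B C (y * z) (z * x) (x * y)) \<longleftrightarrow>
    bary A B C (x * (V + W)) (y * (W + U)) (z * (U + V)) \<in>
      nine_point_conic (ordinary A) (ordinary B) (ordinary C) (bary A B C x y z)"
    unfolding circumconic_O_def Let_def isotomic_bary[OF nz] vimage_eq cevian_map_bary[OF s uvw]
      U_def V_def W_def ..
  also have "\<dots> \<longleftrightarrow> (2 * x * y * z) * (U * (V + W) * x + V * (W + U) * y + W * (U + V) * z) = 0"
    using nz by (subst nine_point_conic_bary[OF _ image_nz]) (simp_all add: algebra_simps)
  also have "\<dots> \<longleftrightarrow> (y + z) * (z + x) * (x + y) * (U * (V + W) * x + V * (W + U) * y + W * (U + V) * z) = 0"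
    using nz s by simp
  also have "(y + z) * (z + x) * (x + y) * (U * (V + W) * x + V * (W + U) * y + W * (U + V) * z) =
    (y + z)\<^sup>2 * v * w + (z + x)\<^sup>2 * w * u + (x + y)\<^sup>2 * u * v"
    unfolding uvw_eq by (simp add: power2_eq_square algebra_simps)
  finally show ?thesis .
qed

end

section \<open>The tangential triangle\<close>

context triangle begin

text \<open>
  A line \<open>\<beta> v + \<gamma> w = 0\<close> through \<open>A\<close> meets the conic in one further point, which coincides with \<open>A\<close>
  only if \<open>c \<gamma> = b \<beta>\<close>.
\<close>

lemma tangent_at_vertex:
  assumes S: "\<And>u v w. (u, v, w) \<noteq> (0, 0, 0) \<Longrightarrow> bary A B C u v w \<in> S \<longleftrightarrow> a * v * w + b * w * u + c * u * v = 0"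
    and "a \<noteq> 0" "b \<noteq> 0" "c \<noteq> 0"
  shows "tangent S (ordinary A) = bary_line 0 c b"
  unfolding tangent_def
proof (rule the_equality, intro conjI)
  show "is_line (bary_line 0 c b)" unfolding is_line_iff
    by (rule exI[of _ 0], rule exI[of _ c], rule exI[of _ b]) (use \<open>c \<noteq> 0\<close> in simp)
  show "bary_line 0 c b \<inter> S = {ordinary A}"
  proof (rule set_eqI)
    fix X
    obtain u v w where X: "X = bary A B C u v w" and nz: "(u, v, w) \<noteq> (0, 0, 0)" by (rule bary_cases)
    have "X \<in> bary_line 0 c b \<inter> S \<longleftrightarrow> c * v + b * w = 0 \<and> a * v * w + b * w * u + c * u * v = 0"
      using S[OF nz] bary_in_line[OF nz] by (simp add: X)
    also have "\<dots> \<longleftrightarrow> v = 0 \<and> w = 0"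
    proof
      assume t: "c * v + b * w = 0 \<and> a * v * w + b * w * u + c * u * v = 0"
      then have "a * (v * w) = 0" by algebra
      then have "v * w = 0" using \<open>a \<noteq> 0\<close> by simp
      then show "v = 0 \<and> w = 0" using t \<open>b \<noteq> 0\<close> \<open>c \<noteq> 0\<close> by auto
    qed simp
    also have "\<dots> \<longleftrightarrow> X \<in> {ordinary A}"
      unfolding X ordinary_vertex singleton_iff using nz by (subst bary_eq_iff) auto
    finally show "X \<in> bary_line 0 c b \<inter> S \<longleftrightarrow> X \<in> {ordinary A}" .
  qed
next
  fix L assume L: "is_line L \<and> L \<inter> S = {ordinary A}"
  then obtain \<alpha> \<beta> \<gamma> where nz: "(\<alpha>, \<beta>, \<gamma>) \<noteq> (0, 0, 0)" and L': "L = bary_line \<alpha> \<beta> \<gamma>"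
    unfolding is_line_iff by blast
  have "ordinary A \<in> bary_line \<alpha> \<beta> \<gamma>" using L L' by blast
  then have \<alpha>: "\<alpha> = 0" unfolding ordinary_vertex by (subst (asm) bary_in_line) auto
  \<comment> \<open>the second point in which a line through \<open>A\<close> meets the conic\<close>
  let ?u = "a * \<beta> * \<gamma>" and ?v = "\<gamma> * (c * \<gamma> - b * \<beta>)" and ?w = "- \<beta> * (c * \<gamma> - b * \<beta>)"
  have eq: "c * \<gamma> = b * \<beta>"
  proof (rule ccontr)
    assume "c * \<gamma> \<noteq> b * \<beta>"
    then have "?v \<noteq> 0 \<or> ?w \<noteq> 0" using nz \<alpha> by auto
    then have uvw: "(?u, ?v, ?w) \<noteq> (0, 0, 0)" by auto
    have "bary A B C ?u ?v ?w \<in> L" unfolding L' bary_in_line[OF uvw] \<alpha> by (simp add: algebra_simps)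
    moreover have "bary A B C ?u ?v ?w \<in> S" unfolding S[OF uvw] by (simp add: algebra_simps)
    ultimately have "bary A B C ?u ?v ?w \<in> {ordinary A}" using L by (metis IntI)
    then have "bary A B C ?u ?v ?w = bary A B C 1 0 0" by (simp only: ordinary_vertex singleton_iff)
    then have "?v = 0 \<and> ?w = 0" using uvw by (subst (asm) bary_eq_iff) simp_all
    then show False using \<open>?v \<noteq> 0 \<or> ?w \<noteq> 0\<close> by blast
  qed
  then have "\<beta> \<noteq> 0" using nz \<alpha> \<open>c \<noteq> 0\<close> by auto
  then have "bary_line ((\<beta> / c) * 0) ((\<beta> / c) * c) ((\<beta> / c) * b) = bary_line 0 c b"
    using \<open>c \<noteq> 0\<close> by (intro bary_line_scale) simp
  moreover have "\<gamma> = \<beta> / c * b" using eq \<open>c \<noteq> 0\<close> by (simp add: field_simps)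
  ultimately show "L = bary_line 0 c b" unfolding L' \<alpha> using \<open>c \<noteq> 0\<close> by simp
qed

text \<open>
  The tangents \<open>c u + a w = 0\<close> at \<open>B\<close> and \<open>b u + a v = 0\<close> at \<open>C\<close> meet in \<open>(-a : b : c)\<close>, which lies on
  the line \<open>c v = b w\<close> joining \<open>A\<close> to \<open>(a : b : c)\<close>.
\<close>

lemma perspector_tangential_triangle:
  assumes S: "\<And>u v w. (u, v, w) \<noteq> (0, 0, 0) \<Longrightarrow> bary A B C u v w \<in> S \<longleftrightarrow> a * v * w + b * w * u + c * u * v = 0"
    and nz: "a \<noteq> 0" "b \<noteq> 0" "c \<noteq> 0"
  shows "is_perspector (ordinary A) (ordinary B) (ordinary C)
    (tangential_vertex S A B C) (tangential_vertex S B C A) (tangential_vertex S C A B) (bary A B C a b c)"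
proof -
  interpret B: triangle B C A by (rule rotate)
  interpret C: triangle C A B by (rule B.rotate)
  have rot: "bary B C A v w u = bary A B C u v w" "bary C A B w u v = bary A B C u v w" for u v w
    by (simp_all add: bary_rotate B.bary_rotate)
  have tA: "tangent S (ordinary A) = bary_line 0 c b"
    using S nz by (rule tangent_at_vertex)
  have SB: "bary B C A v w u \<in> S \<longleftrightarrow> b * w * u + c * u * v + a * v * w = 0" if "(v, w, u) \<noteq> (0, 0, 0)" for u v w
    unfolding rot using that by (subst S) (auto simp: algebra_simps)
  have SC: "bary C A B w u v \<in> S \<longleftrightarrow> c * u * v + a * v * w + b * w * u = 0" if "(w, u, v) \<noteq> (0, 0, 0)" for u v w
    unfolding rot using that by (subst S) (auto simp: algebra_simps)
  have tB: "tangent S (ordinary B) = bary_line c 0 a"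
    unfolding bary_line_rotate[symmetric] by (rule B.tangent_at_vertex[OF _ nz(2,3,1)]) (erule SB)
  have tC: "tangent S (ordinary C) = bary_line b a 0"
    unfolding bary_line_rotate[symmetric] unfolding B.bary_line_rotate[symmetric]
    by (rule C.tangent_at_vertex[OF _ nz(3,1,2)]) (erule SC)
  have A': "tangential_vertex S A B C = bary A B C (- a) b c"
  proof -
    have "meet (bary_line c 0 a) (bary_line b a 0) = bary A B C (a * - a) (a * b) (a * c)"
      by (rule meet_bary_lines) (use nz in simp_all)
    then show ?thesis unfolding tangential_vertex_def tB tC by (simp only: bary_scale[OF nz(1)])
  qed
  have B': "tangential_vertex S B C A = bary A B C a (- b) c"
  proof -
    have "meet (bary_line b a 0) (bary_line 0 c b) = bary A B C (b * a) (b * - b) (b * c)"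
      by (rule meet_bary_lines) (use nz in simp_all)
    then show ?thesis unfolding tangential_vertex_def tA tC by (simp only: bary_scale[OF nz(2)])
  qed
  have C': "tangential_vertex S C A B = bary A B C a b (- c)"
  proof -
    have "meet (bary_line 0 c b) (bary_line c 0 a) = bary A B C (c * a) (c * b) (c * - c)"
      by (rule meet_bary_lines) (use nz in simp_all)
    then show ?thesis unfolding tangential_vertex_def tA tB by (simp only: bary_scale[OF nz(3)])
  qed
  have "line_through (ordinary A) (bary A B C (- a) b c) = bary_line 0 (- c) b"
    "line_through (ordinary B) (bary A B C a (- b) c) = bary_line c 0 (- a)"
    "line_through (ordinary C) (bary A B C a b (- c)) = bary_line (- b) a 0"
    unfolding ordinary_vertex by (rule line_through_bary; use nz in simp)+
  moreover have "ordinary A \<noteq> bary A B C (- a) b c" "ordinary B \<noteq> bary A B C a (- b) c"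
    "ordinary C \<noteq> bary A B C a b (- c)"
    unfolding ordinary_vertex using nz by (simp_all add: bary_eq_iff)
  ultimately show ?thesis
    unfolding is_perspector_def A' B' C' using cevian_lines_meet[OF nz] by simp
qed

end

section \<open>The perspector\<close>

context triangle begin

lemma not_on_sides:
  assumes "bary A B C p q r \<notin> side_points A B C" "(p, q, r) \<noteq> (0, 0, 0)"
  shows "p \<noteq> 0" "q \<noteq> 0" "r \<noteq> 0"
  using assms by (auto simp: side_points_def line_BC line_CA line_AB bary_in_line)

text \<open>
  The vertices of the anticomplementary triangle are \<open>(-1 : 1 : 1)\<close>, \<open>(1 : -1 : 1)\<close>, \<open>(1 : 1 : -1)\<close>, so its
  sides are \<open>q + r = 0\<close>, \<open>r + p = 0\<close>, \<open>p + q = 0\<close>.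
\<close>

lemma not_on_anticomplementary_sides:
  assumes "bary A B C p q r \<notin> side_points (inv (complement_map A B C) A)
      (inv (complement_map A B C) B) (inv (complement_map A B C) C)"
    and nz: "(p, q, r) \<noteq> (0, 0, 0)"
  shows "q + r \<noteq> 0" "r + p \<noteq> 0" "p + q \<noteq> 0"
proof -
  have K: "inv (complement_map A B C) Y = A + B + C - 2 *\<^sub>R Y" for Y
  proof (rule inv_f_eq)
    show "inj (complement_map A B C)" by (rule injI) (simp add: complement_map_def)
    show "complement_map A B C (A + B + C - 2 *\<^sub>R Y) = Y"
      by (simp add: complement_map_def centroid_def vec_eq_iff field_simps)
  qed
  have v: "ordinary (A + B + C - 2 *\<^sub>R A) = bary A B C (- 1) 1 1" "ordinary (A + B + C - 2 *\<^sub>R B) = bary A B C 1 (- 1) 1"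
    "ordinary (A + B + C - 2 *\<^sub>R C) = bary A B C 1 1 (- 1)"
    by (simp_all add: bary_ordinary scaleR_2)
  have "line_through (bary A B C 1 (- 1) 1) (bary A B C 1 1 (- 1)) = bary_line 0 2 2"
    "line_through (bary A B C 1 1 (- 1)) (bary A B C (- 1) 1 1) = bary_line 2 0 2"
    "line_through (bary A B C (- 1) 1 1) (bary A B C 1 (- 1) 1) = bary_line 2 2 0"
    by (rule line_through_bary; simp)+
  then show "q + r \<noteq> 0" "r + p \<noteq> 0" "p + q \<noteq> 0"
    using assms unfolding side_points_def K v by (auto simp: bary_in_line)
qed

end

theorem theorem4p6:
  fixes A B C :: "real^2" and P :: epoint
  assumes "\<not> collinear {A, B, C}"
    and "P \<notin> side_points A B C"
    and "P \<notin> side_points (inv (complement_map A B C) A)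
                         (inv (complement_map A B C) B)
                         (inv (complement_map A B C) C)"
  defines "S \<equiv> circumconic_O A B C P"
  shows "is_perspector (ordinary A) (ordinary B) (ordinary C)
           (tangential_vertex S A B C) (tangential_vertex S B C A) (tangential_vertex S C A B)
           (gen_isogonal A B C P (ordinary (centroid A B C)))"
proof -
  interpret triangle A B C by unfold_locales (rule assms(1))
  obtain p q r where P: "P = bary A B C p q r" and pqr: "(p, q, r) \<noteq> (0, 0, 0)" by (rule bary_cases)
  have nz: "p \<noteq> 0" "q \<noteq> 0" "r \<noteq> 0" using not_on_sides assms(2) pqr unfolding P by blast+
  have sums: "q + r \<noteq> 0" "r + p \<noteq> 0" "p + q \<noteq> 0"
    using not_on_anticomplementary_sides assms(3) pqr unfolding P by blast+
  define x y z where "x = 1 / p" and "y = 1 / q" and "z = 1 / r"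
  have xyz: "x \<noteq> 0" "y \<noteq> 0" "z \<noteq> 0" using nz by (simp_all add: x_def y_def z_def)
  have s: "y + z \<noteq> 0" "z + x \<noteq> 0" "x + y \<noteq> 0"
    using nz sums by (simp_all add: x_def y_def z_def add_frac_eq add.commute)
  have P': "P = bary A B C (y * z) (z * x) (x * y)"
    unfolding P using nz xyz by (subst bary_eq_iff) (simp_all add: x_def y_def z_def)
  have "is_perspector (ordinary A) (ordinary B) (ordinary C)
      (tangential_vertex S A B C) (tangential_vertex S B C A) (tangential_vertex S C A B)
      (bary A B C ((y + z)\<^sup>2) ((z + x)\<^sup>2) ((x + y)\<^sup>2))"
    unfolding S_def P' using s
    by (intro perspector_tangential_triangle circumconic_O_bary[OF xyz s]) simp_all
  then show ?thesis unfolding P' gen_isogonal_centroid[OF xyz s] .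
qed

end
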